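(* Let the family of random variables $\{n/N_n\}_{n\in\mathbb N}$ be weakly relatively compact. Let the normalizing constants have the form $$b_{n,k}=(\sigma_n\sqrt k)^{-1},\quad d_n=(\sigma_n\sqrt n)^{-1},\quad \mathbf a_{n,k}=(\sigma_n k)^{-1}\sqrt n\,\mathbf a_n,\quad \mathbf c_n=(\sigma_n\sqrt n)^{-1}\mathbf b_n\qquad(n,k\in\mathbb N),$$ where $\sigma_n>0$ and $\mathbf a_n,\mathbf b_n\in\mathbb R^m$ are such that $\mathbf a_n\to\mathbf a$ and $\mathbf b_n\to\mathbf b$ as $n\to\infty$ for some $\mathbf a,\mathbf b\in\mathbb R^m$. Assume that the statistic $\mathbf T_{n,k}$ is asymptotically normal in the following sense: there exists a positive definite symmetric matrix $\Sigma$ such that for any $T\in(0,\infty)$ $$\lim_{n\to\infty}\mathsf E\sup_{\|\mathbf t\|\le T}\big|h_{n,N_n}(\mathbf t)-\exp\{-\tfrac12\mathbf t^\top\Sigma\mathbf t\}\big|=0,$$ where $h_{n,k}(\mathbf t)$, $\mathbf t\in\mathbb R^m$, is the characteristic function of the random vector $$\mathbf Y_{n,k}=b_{n,k}^{-1}(\mathbf T_{n,k}-\theta_n-\mathbf a_{n,k})=\sigma_n\sqrt k\,(\mathbf T_{n,k}-\theta_n)-\sqrt{n/k}\,\mathbf a_n.$$ Then a random vector $\mathbf Z$ such that $$\sigma_n\sqrt n\,(\mathbf T_{n,N_n}-\theta_n)-\mathbf b_n\Longrightarrow\mathbf Z\qquad(n\to\infty)$$ exists if and only if there exists a distribution function $G$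 such that $G(0)=0$, the distribution $F$ of $\mathbf Z$ has the form $F=N_{\mathbf b+z\mathbf a,\,z\Sigma}\circ G$, and $$\mathsf P(n/N_n<x)\Longrightarrow G(x)\qquad(n\to\infty).$$
   Context: Fix $m,r\in\mathbb N=\{1,2,\dots\}$. All random variables and vectors are defined on one probability space $(\Omega,\mathfrak F,\mathsf P)$; $\mathsf E$ is expectation, $\|\cdot\|$ is the Euclidean norm and $\Longrightarrow$ denotes weak convergence (convergence in distribution). A family of random variables is weakly relatively compact if each sequence of its elements contains a weakly convergent subsequence (equivalently, it is tight). $\{\mathbf X_{n,j}\}_{j\ge1}$, $n\in\mathbb N$, is a double array of row-wise independent, not necessarily identically distributed random vectors with values in $\mathbb R^r$. For $n,k\in\mathbb N$, $\mathbf T_{n,k}=\mathbf T_{n,k}(\mathbf X_{n,1},\dots,\mathbf X_{n,k})$ is a statistic, i.e. a measurable function of $\mathbf X_{n,1},\dots,\mathbf X_{n,k}$ with values in $\mathbb R^m$. The $\theta_n$, $n\in\mathbb N$, are (non-random) vectors in $\mathbb R^m$. $\{N_n\}_{n\in\mathbb N}$ is a family of integer random variables with values in $\{1,2,\dots\}$ such that for each $n,k\in\mathbb N$ the random variable $N_n$ and the random vector $\mathbf T_{n,k}-\theta_n$ are independent. The random vector $\mathbf T_{n,N_n}$ is defined by $\mathbf T_{n,N_n}(\omega)=\mathbf T_{n,N_n(\omega)}(\mathbf X_{n,1}(\omega),\dots,\mathbf X_{n,N_n(\omega)}(\omega))$, $\omega\in\Omega$, and $h_{n,N_n}(\mathbf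 t)$ is $h_{n,k}(\mathbf t)$ with $k=N_n$ substituted. $N_{\mathbf c,\Sigma}$ denotes the $m$-dimensional normal distribution with mean vector $\mathbf c$ and covariance matrix $\Sigma$. For $\mathbf a,\mathbf b\in\mathbb R^m$ and a probability measure $G$ on $[0,\infty)$ (identified with its distribution function), the normal variance-mean mixture $F=N_{\mathbf b+z\mathbf a,\,z\Sigma}\circ G$ is the probability measure on $\mathbb R^m$ given by $$F(d\mathbf x)=\int_0^\infty N_{\mathbf b+z\mathbf a,\,z\Sigma}(d\mathbf x)\,G(dz).$$
   Formalization: The limit law is taken as F = N_{-b+za, zΣ}∘G instead of N_{b+za, zΣ}∘G: with the normalization σ_n√n(T−θ_n) − b_n as displayed, the printed sign of b is false whenever b ≠ 0 and a limit exists. *)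

theory Defs
  imports "HOL-Probability.Probability"
begin

definition borel_prob :: "'a::topological_space measure \<Rightarrow> bool" where
  "borel_prob \<mu> \<longleftrightarrow> prob_space \<mu> \<and> sets \<mu> = sets borel"

text \<open>The library's \<^const>\<open>weak_conv_m\<close> is restricted to laws on the real line.\<close>

definition weak_conv_vec :: "(nat \<Rightarrow> 'a::topological_space measure) \<Rightarrow> 'a measure \<Rightarrow> bool" where
  "weak_conv_vec \<mu> \<nu> \<longleftrightarrow>
     (\<forall>f::'a \<Rightarrow> real. continuous_on UNIV f \<and> bounded (range f) \<longrightarrow>
        (\<lambda>n. \<integral>x. f x \<partial>(\<mu> n)) \<longlonglongrightarrow> (\<integral>x. f x \<partial>\<nu>))"

definition weakly_relatively_compact :: "real measure set \<Rightarrow> bool" where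
  "weakly_relatively_compact \<M> \<longleftrightarrow>
     (\<forall>\<mu>::nat \<Rightarrow> real measure. range \<mu> \<subseteq> \<M> \<longrightarrow>
        (\<exists>s \<nu>. strict_mono s \<and> real_distribution \<nu> \<and> weak_conv_m (\<mu> \<circ> s) \<nu>))"

definition char_vec :: "'a::real_inner measure \<Rightarrow> 'a \<Rightarrow> complex" where
  "char_vec \<mu> t = (CLINT x|\<mu>. iexp (t \<bullet> x))"

definition pos_def_sym :: "real^'m^'m \<Rightarrow> bool" where
  "pos_def_sym S \<longleftrightarrow> transpose S = S \<and> (\<forall>x. x \<noteq> 0 \<longrightarrow> 0 < x \<bullet> (S *v x))"

definition std_mvnormal :: "(real^'m) measure" where
  "std_mvnormal = density lborel (\<lambda>x. ennreal (\<Prod>i\<in>UNIV. std_normal_density (x $ i)))"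

text \<open>
  The law of \<open>c + A W\<close> with \<open>W\<close> standard normal and \<open>A A\<^sup>T = S\<close>. It does not depend on the
  choice of \<open>A\<close>. Singular covariance matrices are covered; \<open>S = 0\<close> gives the point mass at \<open>c\<close>.
  The definition is meaningful only for symmetric positive semidefinite \<open>S\<close>.
\<close>

definition mvnormal :: "real^'m \<Rightarrow> real^'m^'m \<Rightarrow> (real^'m) measure" where
  "mvnormal c S =
     distr std_mvnormal borel (\<lambda>x. c + (SOME A :: real^'m^'m. A ** transpose A = S) *v x)"

text \<open>
  \<open>F(dx) = \<integral> N\<^bsub>b + z a, z S\<^esub>(dx) G(dz)\<close>, where the mixing law \<open>G\<close> is given as a law on the whole
  real line. The mixture makes sense only if \<open>G\<close> is concentrated on the half-line \<open>z \<ge> 0\<close>.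
\<close>

definition normal_var_mean_mixture ::
    "real^'m \<Rightarrow> real^'m \<Rightarrow> real^'m^'m \<Rightarrow> real measure \<Rightarrow> (real^'m) measure" where
  "normal_var_mean_mixture b a S G = G \<bind> (\<lambda>z. mvnormal (b + z *\<^sub>R a) (z *\<^sub>R S))"

text \<open>
  The distribution function of \<open>G\<close> is taken to be left-continuous, \<open>G(x) = G{y. y < x}\<close>, so that
  \<open>G(0) = 0\<close> says that \<open>G\<close> lives on \<open>[0,\<infinity>)\<close>. An atom at \<open>0\<close> is allowed: it arises as
  the limit law of \<open>n / N\<^sub>n\<close> when, for instance, \<open>N\<^sub>n = n\<^sup>2\<close>.
\<close>

definition mixing_law :: "real measure \<Rightarrow> bool" where
  "mixing_law G \<longleftrightarrow> real_distribution G \<and> measure G {..<0} = 0"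

text \<open>
  The library's \<open>prob_space.indep_var\<close> forces both random variables to take values in the same type.
\<close>

definition indep_rv ::
    "'w measure \<Rightarrow> 'x measure \<Rightarrow> ('w \<Rightarrow> 'x) \<Rightarrow> 'y measure \<Rightarrow> ('w \<Rightarrow> 'y) \<Rightarrow> bool" where
  "indep_rv M S X T Y \<longleftrightarrow> X \<in> measurable M S \<and> Y \<in> measurable M T \<and>
     prob_space.indep_set M {X -` A \<inter> space M | A. A \<in> sets S} {Y -` B \<inter> space M | B. B \<in> sets T}"

definition statistic ::
    "(nat \<Rightarrow> nat \<Rightarrow> 'w \<Rightarrow> 'x) \<Rightarrow> (nat \<Rightarrow> nat \<Rightarrow> (nat \<Rightarrow> 'x) \<Rightarrow> 'y) \<Rightarrow>
     nat \<Rightarrow> nat \<Rightarrow> 'w \<Rightarrow> 'y" where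
  "statistic X T n k \<omega> = T n k (\<lambda>j\<in>{1..k}. X n j \<omega>)"

text \<open>
  With scale \<open>b\<^bsub>n,k\<^esub> = 1 / (\<sigma>\<^sub>n \<surd>k)\<close> and centring \<open>a\<^bsub>n,k\<^esub> = \<surd>n a\<^sub>n / (\<sigma>\<^sub>n k)\<close>,
  respectively \<open>d\<^sub>n = 1 / (\<sigma>\<^sub>n \<surd>n)\<close> and \<open>c\<^sub>n = b\<^sub>n / (\<sigma>\<^sub>n \<surd>n)\<close>.
\<close>

definition scale_coeff :: "(nat \<Rightarrow> real) \<Rightarrow> nat \<Rightarrow> nat \<Rightarrow> real" where
  "scale_coeff \<sigma> n k = 1 / (\<sigma> n * sqrt (real k))"

definition centre_coeff :: "(nat \<Rightarrow> real) \<Rightarrow> (nat \<Rightarrow> real^'m) \<Rightarrow> nat \<Rightarrow> nat \<Rightarrow> real^'m" where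
  "centre_coeff \<sigma> a n k = (sqrt (real n) / (\<sigma> n * real k)) *\<^sub>R a n"

definition outer_scale :: "(nat \<Rightarrow> real) \<Rightarrow> nat \<Rightarrow> real" where
  "outer_scale \<sigma> n = 1 / (\<sigma> n * sqrt (real n))"

definition outer_centre :: "(nat \<Rightarrow> real) \<Rightarrow> (nat \<Rightarrow> real^'m) \<Rightarrow> nat \<Rightarrow> real^'m" where
  "outer_centre \<sigma> b n = (1 / (\<sigma> n * sqrt (real n))) *\<^sub>R b n"

definition normalized_statistic ::
    "(nat \<Rightarrow> nat \<Rightarrow> 'w \<Rightarrow> 'x) \<Rightarrow> (nat \<Rightarrow> nat \<Rightarrow> (nat \<Rightarrow> 'x) \<Rightarrow> real^'m) \<Rightarrow> (nat \<Rightarrow> real^'m) \<Rightarrow>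
     (nat \<Rightarrow> real) \<Rightarrow> (nat \<Rightarrow> real^'m) \<Rightarrow> nat \<Rightarrow> nat \<Rightarrow> 'w \<Rightarrow> real^'m" where
  "normalized_statistic X T \<theta> \<sigma> a n k \<omega> =
     inverse (scale_coeff \<sigma> n k) *\<^sub>R (statistic X T n k \<omega> - \<theta> n - centre_coeff \<sigma> a n k)"

definition random_size_statistic ::
    "(nat \<Rightarrow> nat \<Rightarrow> 'w \<Rightarrow> 'x) \<Rightarrow> (nat \<Rightarrow> nat \<Rightarrow> (nat \<Rightarrow> 'x) \<Rightarrow> real^'m) \<Rightarrow> (nat \<Rightarrow> real^'m) \<Rightarrow>
     (nat \<Rightarrow> real) \<Rightarrow> (nat \<Rightarrow> real^'m) \<Rightarrow> (nat \<Rightarrow> 'w \<Rightarrow> nat) \<Rightarrow> nat \<Rightarrow> 'w \<Rightarrow> real^'m" where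
  "random_size_statistic X T \<theta> \<sigma> b N n \<omega> =
     inverse (outer_scale \<sigma> n) *\<^sub>R
       (statistic X T n (N n \<omega>) \<omega> - \<theta> n - outer_centre \<sigma> b n)"

lemma normalized_statistic_eq:
  assumes "\<sigma> n > 0" "n \<ge> 1" "k \<ge> 1"
  shows "normalized_statistic X T \<theta> \<sigma> a n k \<omega> =
    (\<sigma> n * sqrt (real k)) *\<^sub>R (statistic X T n k \<omega> - \<theta> n) - sqrt (real n / real k) *\<^sub>R a n"
proof -
  have "\<sigma> n * sqrt (real k) * (sqrt (real n) / (\<sigma> n * real k)) = sqrt (real n / real k)"
    using assms by (simp add: real_sqrt_divide field_simps)
  then show ?thesis
    by (simp add: normalized_statistic_def scale_coeff_def centre_coeff_def
        scaleR_diff_right inverse_eq_divide)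
qed

lemma random_size_statistic_eq:
  assumes "\<sigma> n > 0" "n \<ge> 1"
  shows "random_size_statistic X T \<theta> \<sigma> b N n \<omega> =
    (\<sigma> n * sqrt (real n)) *\<^sub>R (statistic X T n (N n \<omega>) \<omega> - \<theta> n) - b n"
  using assms
  by (simp add: random_size_statistic_def outer_scale_def outer_centre_def
      scaleR_diff_right inverse_eq_divide)

text \<open>
  The randomly indexed vector is \<open>\<surd>(n / N\<^sub>n) Y\<^bsub>n,N\<^sub>n\<^esub> + (n / N\<^sub>n) a\<^sub>n - b\<^sub>n\<close>. The part of the limit's
  mean that does not depend on the mixing variable is therefore \<open>- b\<close>, not \<open>b\<close>.
\<close>

lemma random_size_statistic_decomp:
  assumes "\<sigma> n > 0" "n \<ge> 1" "N n \<omega> \<ge> 1"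
  shows "random_size_statistic X T \<theta> \<sigma> b N n \<omega> =
    sqrt (real n / real (N n \<omega>)) *\<^sub>R normalized_statistic X T \<theta> \<sigma> a n (N n \<omega>) \<omega>
      + (real n / real (N n \<omega>)) *\<^sub>R a n - b n"
proof -
  have "sqrt (real n / real (N n \<omega>)) * (\<sigma> n * sqrt (real (N n \<omega>))) = \<sigma> n * sqrt (real n)"
    using assms by (simp add: real_sqrt_divide)
  note scale = this
  have "random_size_statistic X T \<theta> \<sigma> b N n \<omega> =
      (\<sigma> n * sqrt (real n)) *\<^sub>R (statistic X T n (N n \<omega>) \<omega> - \<theta> n) - b n"
    using assms by (intro random_size_statistic_eq)
  moreover have "normalized_statistic X T \<theta> \<sigma> a n (N n \<omega>) \<omega> =
      (\<sigma> n * sqrt (real (N n \<omega>))) *\<^sub>R (statistic X T n (N n \<omega>) \<omega> - \<theta> n)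
        - sqrt (real n / real (N n \<omega>)) *\<^sub>R a n"
    using assms by (intro normalized_statistic_eq)
  moreover have "sqrt (real n / real (N n \<omega>)) * sqrt (real n / real (N n \<omega>)) = real n / real (N n \<omega>)"
    by simp
  ultimately show ?thesis
    by (simp only: scaleR_diff_right[of "sqrt _"] scaleR_scaleR scale) simp
qed

end

theory Submission
  imports Defs "HOL-Complex_Analysis.Conformal_Mappings"
begin

text \<open>
  Put \<open>U\<^sub>n = n / N\<^sub>n\<close>. The normalized statistic of random sample size is
  \<open>Z\<^sub>n = \<surd>U\<^sub>n Y\<^bsub>n,N\<^sub>n\<^esub> + U\<^sub>n a\<^sub>n - b\<^sub>n\<close>. Since \<open>N\<^sub>n\<close> is independent of each \<open>T\<^bsub>n,k\<^esub>\<close>, one may average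
  over the statistic first and over the sample size afterwards, so the characteristic function of
  \<open>Z\<^sub>n\<close> is the expectation of
  \<open>h\<^bsub>n,N\<^sub>n\<^esub>(\<surd>U\<^sub>n t) exp(i (U\<^sub>n t\<cdot>a\<^sub>n - t\<cdot>b\<^sub>n))\<close> (\<open>char_Z_law\<close>). Relative compactness makes the laws of
  \<open>U\<^sub>n\<close> tight. Outside an event of small probability \<open>\<surd>U\<^sub>n t\<close> therefore stays in a fixed ball, on which
  asymptotic normality replaces \<open>h\<close> by the Gaussian characteristic function uniformly. Hence the
  characteristic function of \<open>Z\<^sub>n\<close> differs by \<open>o(1)\<close> from the expectation of
  \<open>\<kappa>\<^sub>t(U\<^sub>n)\<close>, where \<open>\<kappa>\<^sub>t(u) = exp(i t\<cdot>(u a - b) - u t\<cdot>\<Sigma>t / 2)\<close>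
  (\<open>char_Z_law_minus_mixture_tendsto\<close>).

  If \<open>U\<^sub>n\<close> converges weakly to \<open>G\<close>, along the whole sequence or along a subsequence, then these
  expectations converge to \<open>\<integral> \<kappa>\<^sub>t dG\<close>, because \<open>\<kappa>\<^sub>t\<close> is bounded and continuous on \<open>[0,\<infinity>)\<close>. The limit is the
  characteristic function of the normal mixture with mixing law \<open>G\<close>, and the continuity
  theorem on Euclidean space gives the weak convergence of \<open>Z\<^sub>n\<close> (\<open>weak_conv_to_mixture\<close>).

  Conversely, let \<open>Z\<^sub>n\<close> converge weakly to \<open>F\<close>. By tightness \<open>U\<^sub>n\<close> has subsequential weak limits, and
  by the first part each of them is a mixing law that represents \<open>F\<close> as a normal mixture. The mixture determines
  its mixing law (\<open>mixture_inject\<close>): its characteristic function at \<open>t\<close> is, up to a known factor,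
  the Laplace transform of \<open>G\<close> at \<open>t\<cdot>\<Sigma>t / 2 - i t\<cdot>a\<close>; these points contain a curve inside the right
  half-plane, where the Laplace transform is holomorphic. So all subsequential limits of \<open>U\<^sub>n\<close>
  agree, and with tightness the whole sequence converges (\<open>weak_conv_iff_mixture\<close>).

  Three ingredients from general theory are proved on the way: the continuity theorem for characteristic
  functions of random vectors with a prescribed limit law (\<open>char_vec_tendsto_imp_weak_conv_vec\<close>), by
  Gaussian smoothing; the factorization \<open>\<Sigma> = A A\<^sup>T\<close> (\<open>pos_def_sym_factor\<close>), which identifies the normal
  law with covariance matrix \<open>\<Sigma>\<close>; and the uniform bound on the upper tails of a relatively compact family of laws on the line
  (\<open>weakly_relatively_compact_tail\<close>).
\<close>

section \<open>The standard normal law on Euclidean space\<close>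

text \<open>
  Fubini for integrands that are products of functions of single coordinates: Lebesgue measure is
  the image of the product measure indexed by the standard basis, and the basis is
  reindexed by the coordinates.
\<close>

lemma has_bochner_integral_lborel_prod:
  fixes f :: "'m::finite \<Rightarrow> real \<Rightarrow> 'b::{real_normed_field,banach,second_countable_topology}"
  assumes f: "\<And>i. integrable lborel (f i)"
  shows "has_bochner_integral lborel (\<lambda>x::real^'m. \<Prod>i\<in>UNIV. f i (x $ i))
           (\<Prod>i\<in>UNIV. integral\<^sup>L lborel (f i))"
proof -
  have [measurable]: "f i \<in> borel_measurable borel" for i
    using f[of i] by auto
  interpret product_sigma_finite "\<lambda>_::real^'m. lborel :: real measure" ..
  have bij: "bij_betw (\<lambda>i::'m. axis i (1::real)) UNIV Basis"
    by (auto simp: bij_betw_def inj_on_def axis_eq_axis Basis_vec_def)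
  define ix where "ix = (\<lambda>b::real^'m. the_inv_into UNIV (\<lambda>i::'m. axis i (1::real)) b)"
  have ix: "ix (axis i 1) = i" for i
    unfolding ix_def using bij by (intro the_inv_into_f_f) (auto simp: bij_betw_def)
  have reindex: "(\<Prod>i\<in>UNIV. F i) = (\<Prod>b\<in>Basis. F (ix b))" for F :: "'m \<Rightarrow> 'b"
    using prod.reindex_bij_betw[OF bij, of "\<lambda>b. F (ix b)"] by (simp add: ix)
  have component: "(\<Sum>c\<in>Basis. x c *\<^sub>R c) $ ix b = x b" if b_in: "b \<in> Basis" for x and b :: "real^'m"
  proof -
    obtain i where b: "b = axis i 1" using b_in by (auto simp: Basis_vec_def)
    have "(\<Sum>c\<in>Basis. x c *\<^sub>R c) $ i = (\<Sum>c\<in>Basis. x c *\<^sub>R c) \<bullet> b"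
      by (simp add: b inner_axis)
    also have "\<dots> = x b" using b_in by (simp add: inner_sum_left inner_Basis if_distrib sum.delta cong: if_cong)
    finally show ?thesis by (simp add: b ix)
  qed
  have eq: "(\<lambda>x. (\<Prod>i\<in>UNIV. f i ((\<Sum>c\<in>Basis. x c *\<^sub>R c) $ i))) = (\<lambda>x. \<Prod>b\<in>Basis. f (ix b) (x b))"
    unfolding reindex by (intro ext prod.cong) (simp_all only: component)
  have meas: "(\<lambda>x. \<Sum>b\<in>(Basis::(real^'m) set). x b *\<^sub>R b) \<in> measurable (\<Pi>\<^sub>M b\<in>Basis. lborel) borel"
    by measurable
  show ?thesis
    unfolding has_bochner_integral_iff lborel_eq[where 'a="real^'m"]
  proof
    show "integrable (distr (\<Pi>\<^sub>M b\<in>Basis. lborel) borel (\<lambda>f. \<Sum>b\<in>Basis. f b *\<^sub>R b))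
        (\<lambda>x::real^'m. \<Prod>i\<in>UNIV. f i (x $ i))"
      by (subst integrable_distr_eq[OF meas], measurable, unfold eq, intro product_integrable_prod f finite_Basis)
    show "integral\<^sup>L (distr (\<Pi>\<^sub>M b\<in>Basis. lborel) borel (\<lambda>f. \<Sum>b\<in>Basis. f b *\<^sub>R b))
        (\<lambda>x::real^'m. \<Prod>i\<in>UNIV. f i (x $ i)) = (\<Prod>i\<in>UNIV. integral\<^sup>L lborel (f i))"
      by (subst integral_distr[OF meas], measurable,
          unfold eq reindex[of "\<lambda>i. integral\<^sup>L lborel (f i)"],
          intro product_integral_prod f finite_Basis)
  qed
qed

definition std_mvnormal_density :: "real^'m \<Rightarrow> real" where
  "std_mvnormal_density x = (\<Prod>i\<in>UNIV. std_normal_density (x $ i))"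

lemma std_mvnormal_density_measurable [measurable]: "std_mvnormal_density \<in> borel_measurable borel"
  unfolding std_mvnormal_density_def by measurable

lemma std_mvnormal_density_nonneg: "0 \<le> std_mvnormal_density x"
  by (simp add: std_mvnormal_density_def prod_nonneg)

lemma std_mvnormal_density_eq:
  "std_mvnormal_density (x::real^'m) = (1 / sqrt (2 * pi)) ^ CARD('m) * exp (- (x \<bullet> x) / 2)"
  by (simp add: std_mvnormal_density_def normal_density_def prod.distrib prod_dividef
      exp_sum[symmetric] inner_vec_def power2_eq_square sum_divide_distrib sum_negf power_divide)

lemma std_mvnormal_density_le: "std_mvnormal_density (x::real^'m) \<le> (1 / sqrt (2 * pi)) ^ CARD('m)"
  unfolding std_mvnormal_density_eq by (intro mult_left_le) auto

lemma std_mvnormal_eq: "std_mvnormal = density lborel (\<lambda>x. ennreal (std_mvnormal_density x))"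
  by (simp add: std_mvnormal_def std_mvnormal_density_def)

lemma sets_std_mvnormal [simp, measurable_cong]: "sets std_mvnormal = sets borel"
  by (simp add: std_mvnormal_def)

lemma space_std_mvnormal [simp]: "space std_mvnormal = UNIV"
  by (simp add: std_mvnormal_def)

lemma has_bochner_integral_std_mvnormal_density:
  "has_bochner_integral lborel (std_mvnormal_density :: real^'m \<Rightarrow> real) 1"
  using has_bochner_integral_lborel_prod[of "\<lambda>_::'m. std_normal_density"]
  by (simp add: std_mvnormal_density_def[abs_def])

lemma prob_space_std_mvnormal: "prob_space (std_mvnormal :: (real^'m) measure)"
proof
  have "(\<integral>\<^sup>+x. ennreal (std_mvnormal_density (x::real^'m)) \<partial>lborel) = 1"
    using has_bochner_integral_std_mvnormal_density[where 'm='m]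
    by (subst nn_integral_eq_integral)
       (auto simp: std_mvnormal_density_nonneg has_bochner_integral_iff)
  then show "emeasure (std_mvnormal :: (real^'m) measure) (space std_mvnormal) = 1"
    by (simp add: std_mvnormal_eq emeasure_density)
qed

interpretation std_mvnormal: prob_space std_mvnormal
  by (rule prob_space_std_mvnormal)

lemma prob_std_mvnormal_UNIV [simp]: "measure std_mvnormal UNIV = 1"
  using std_mvnormal.prob_space by simp

lemma integral_std_mvnormal:
  fixes f :: "real^'m \<Rightarrow> 'b::{banach,second_countable_topology}"
  assumes "f \<in> borel_measurable borel"
  shows "integral\<^sup>L std_mvnormal f = (\<integral>x. std_mvnormal_density x *\<^sub>R f x \<partial>lborel)"
  unfolding std_mvnormal_eq
  by (rule integral_density) (use assms in \<open>auto simp: std_mvnormal_density_nonneg\<close>)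

text \<open>
  Both the density and the exponential factor over the coordinates, which reduces the claim to
  the one-dimensional standard normal law.
\<close>

lemma char_std_mvnormal: "char_vec std_mvnormal (t::real^'m) = exp (- (t \<bullet> t) / 2)"
proof -
  have int: "integrable lborel (\<lambda>x. std_normal_density x *\<^sub>R iexp (s * x))" for s
  proof -
    interpret real_distribution std_normal_distribution by (rule real_dist_normal_dist)
    have "integrable std_normal_distribution (\<lambda>x. iexp (s * x))"
      by (rule integrable_iexp) auto
    then show ?thesis by (subst (asm) integrable_density) auto
  qed
  have one_dim: "(\<integral>x. std_normal_density x *\<^sub>R iexp (s * x) \<partial>lborel) = exp (- (s\<^sup>2) / 2)" for s
    using fun_cong[OF char_std_normal_distribution, of s]
    by (simp add: char_def integral_density)
  have "char_vec std_mvnormal t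
      = (\<integral>x. (\<Prod>i\<in>UNIV. std_normal_density (x $ i) *\<^sub>R iexp (t $ i * x $ i)) \<partial>lborel)"
    unfolding char_vec_def
    by (subst integral_std_mvnormal)
       (auto simp: std_mvnormal_density_def scaleR_conv_of_real prod.distrib inner_vec_def
          exp_sum[symmetric] sum_distrib_left)
  also have "\<dots> = (\<Prod>i\<in>UNIV. exp (- ((t $ i)\<^sup>2) / 2))"
    using has_bochner_integral_lborel_prod[of "\<lambda>i x. std_normal_density x *\<^sub>R iexp (t $ i * x)", OF int]
    by (simp only: has_bochner_integral_iff one_dim of_real_prod)
  also have "\<dots> = exp (- (t \<bullet> t) / 2)"
    by (simp add: exp_sum[symmetric] inner_vec_def power2_eq_square sum_negf sum_divide_distrib
        flip: of_real_prod)
  finally show ?thesis .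
qed

section \<open>The continuity theorem for characteristic functions on Euclidean space\<close>

lemma borel_probD:
  assumes "borel_prob \<nu>"
  shows "prob_space \<nu>" "sets \<nu> = sets borel" "space \<nu> = UNIV"
  using assms sets_eq_imp_space_eq[of \<nu> borel] by (auto simp: borel_prob_def)

lemma char_vec_measurable [measurable]:
  fixes \<nu> :: "(real^'m) measure"
  assumes "borel_prob \<nu>"
  shows "char_vec \<nu> \<in> borel_measurable borel"
proof -
  interpret prob_space \<nu> using assms by (rule borel_probD)
  have [measurable_cong]: "sets \<nu> = sets borel" using assms by (rule borel_probD)
  show ?thesis unfolding char_vec_def[abs_def] by measurable
qed

lemma norm_char_vec_le:
  fixes \<nu> :: "(real^'m) measure"
  assumes "borel_prob \<nu>"
  shows "norm (char_vec \<nu> t) \<le> 1"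
proof -
  interpret prob_space \<nu> using assms by (rule borel_probD)
  have "norm (char_vec \<nu> t) \<le> (\<integral>x. norm (iexp (t \<bullet> x)) \<partial>\<nu>)"
    unfolding char_vec_def by (rule integral_norm_bound)
  then show ?thesis by (simp add: prob_space)
qed

text \<open>
  The Gaussian density is a constant times its own characteristic function. Inserting
  this and exchanging the integrals expresses a Gaussian convolution of \<open>\<nu>\<close> through values of
  \<open>char_vec \<nu>\<close> alone, with no integrability condition on \<open>char_vec \<nu>\<close>.
\<close>

lemma integral_Gaussian_kernel:
  fixes \<nu> :: "(real^'m) measure"
  assumes \<nu>: "borel_prob \<nu>" and \<epsilon>: "\<epsilon> > 0"
  shows "complex_of_real (\<integral>x. std_mvnormal_density ((y - x) /\<^sub>R \<epsilon>) \<partial>\<nu>)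
    = complex_of_real ((1 / sqrt (2 * pi)) ^ CARD('m)) *
        (CLINT w|std_mvnormal. iexp ((y /\<^sub>R \<epsilon>) \<bullet> w) * char_vec \<nu> (- (w /\<^sub>R \<epsilon>)))"
proof -
  interpret prob_space \<nu> using \<nu> by (rule borel_probD)
  have sets_nu [measurable_cong]: "sets \<nu> = sets borel" using \<nu> by (rule borel_probD)
  interpret P: pair_prob_space \<nu> "std_mvnormal :: (real^'m) measure" ..
  let ?c = "complex_of_real ((1 / sqrt (2 * pi)) ^ CARD('m))"
  have kernel: "complex_of_real (std_mvnormal_density x) = ?c * (CLINT w|std_mvnormal. iexp (x \<bullet> w))"
    for x :: "real^'m"
    using char_std_mvnormal[of x] unfolding char_vec_def
    by (simp add: std_mvnormal_density_eq)
  have meas: "(\<lambda>(x, w). iexp (((y - x) /\<^sub>R \<epsilon>) \<bullet> w)) \<in> borel_measurable (\<nu> \<Otimes>\<^sub>M std_mvnormal)"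
    by measurable
  have int: "integrable (\<nu> \<Otimes>\<^sub>M std_mvnormal) (\<lambda>(x, w). iexp (((y - x) /\<^sub>R \<epsilon>) \<bullet> w))"
    using meas by (intro P.P.integrable_const_bound[of _ 1]) auto
  have "complex_of_real (\<integral>x. std_mvnormal_density ((y - x) /\<^sub>R \<epsilon>) \<partial>\<nu>)
      = (CLINT x|\<nu>. ?c * (CLINT w|std_mvnormal. iexp (((y - x) /\<^sub>R \<epsilon>) \<bullet> w)))"
    by (simp only: integral_complex_of_real[symmetric] kernel)
  also have "\<dots> = ?c * (CLINT x|\<nu>. CLINT w|std_mvnormal. iexp (((y - x) /\<^sub>R \<epsilon>) \<bullet> w))"
    by (rule integral_mult_right_zero)
  also have "(CLINT x|\<nu>. CLINT w|std_mvnormal. iexp (((y - x) /\<^sub>R \<epsilon>) \<bullet> w))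
      = (CLINT w|std_mvnormal. CLINT x|\<nu>. iexp (((y - x) /\<^sub>R \<epsilon>) \<bullet> w))"
    using P.Fubini_integral[OF int] by simp
  also have "\<dots> = (CLINT w|std_mvnormal. iexp ((y /\<^sub>R \<epsilon>) \<bullet> w) * char_vec \<nu> (- (w /\<^sub>R \<epsilon>)))"
  proof (intro Bochner_Integration.integral_cong refl)
    fix w :: "real^'m"
    have "iexp (((y - x) /\<^sub>R \<epsilon>) \<bullet> w) = iexp ((y /\<^sub>R \<epsilon>) \<bullet> w) * iexp (- (w /\<^sub>R \<epsilon>) \<bullet> x)" for x
      by (simp add: exp_add[symmetric] inner_simps inner_commute algebra_simps)
    then show "(CLINT x|\<nu>. iexp (((y - x) /\<^sub>R \<epsilon>) \<bullet> w)) = iexp ((y /\<^sub>R \<epsilon>) \<bullet> w) * char_vec \<nu> (- (w /\<^sub>R \<epsilon>))"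
      by (simp only: char_vec_def integral_mult_right_zero)
  qed
  finally show ?thesis .
qed

lemma Gaussian_smoothing_eq:
  fixes f :: "real^'m \<Rightarrow> real"
  assumes [measurable]: "f \<in> borel_measurable borel" and \<epsilon>: "\<epsilon> > 0"
  shows "(\<integral>w. f (x + \<epsilon> *\<^sub>R w) \<partial>std_mvnormal)
    = (\<integral>y. f y * std_mvnormal_density ((y - x) /\<^sub>R \<epsilon>) \<partial>lborel) / \<epsilon> ^ CARD('m)"
proof -
  let ?F = "\<lambda>y. f y * std_mvnormal_density ((y - x) /\<^sub>R \<epsilon>)"
  have "(\<integral>y. ?F y \<partial>lborel) =
      (\<integral>y. ?F y \<partial>density (distr lborel borel (\<lambda>w. x + \<epsilon> *\<^sub>R w)) (\<lambda>_. \<bar>\<epsilon>\<bar> ^ DIM(real^'m)))"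
    using lborel_affine[of \<epsilon> x] \<epsilon> by simp
  also have "\<dots> = (\<integral>y. \<epsilon> ^ CARD('m) * ?F y \<partial>distr lborel borel (\<lambda>w. x + \<epsilon> *\<^sub>R w))"
    using \<epsilon> by (subst integral_density) (auto simp: ennreal_power)
  also have "\<dots> = (\<integral>w. \<epsilon> ^ CARD('m) * ?F (x + \<epsilon> *\<^sub>R w) \<partial>lborel)"
    by (subst integral_distr) auto
  also have "\<dots> = \<epsilon> ^ CARD('m) * (\<integral>w. f (x + \<epsilon> *\<^sub>R w) \<partial>std_mvnormal)"
    using \<epsilon> by (subst integral_std_mvnormal) (auto simp: mult.left_commute[of "std_mvnormal_density _"] mult.commute[of "f _"])
  finally show ?thesis using \<epsilon> by simp
qed

text \<open>
  An inversion formula for the smoothed test function. Its right-hand side depends on \<open>\<nu>\<close> only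
  through \<open>char_vec \<nu>\<close> and passes to the limit under pointwise convergence of the latter.
\<close>

lemma integral_Gaussian_smoothing:
  fixes \<nu> :: "(real^'m) measure" and f :: "real^'m \<Rightarrow> real"
  assumes \<nu>: "borel_prob \<nu>" and \<epsilon>: "\<epsilon> > 0"
    and f [measurable]: "f \<in> borel_measurable borel" and int_f: "integrable lborel f"
  shows "complex_of_real (\<integral>x. (\<integral>w. f (x + \<epsilon> *\<^sub>R w) \<partial>std_mvnormal) \<partial>\<nu>)
    = complex_of_real ((1 / sqrt (2 * pi)) ^ CARD('m) / \<epsilon> ^ CARD('m)) *
        (CLINT y|lborel. f y * (CLINT w|std_mvnormal. iexp ((y /\<^sub>R \<epsilon>) \<bullet> w) * char_vec \<nu> (- (w /\<^sub>R \<epsilon>))))"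
proof -
  interpret prob_space \<nu> using \<nu> by (rule borel_probD)
  have sets_nu [measurable_cong]: "sets \<nu> = sets borel" using \<nu> by (rule borel_probD)
  interpret P: pair_sigma_finite \<nu> "lborel :: (real^'m) measure" ..
  let ?k = "\<lambda>x y. std_mvnormal_density ((y - x) /\<^sub>R \<epsilon>)"
  have k_le: "\<bar>?k x y\<bar> \<le> (1 / sqrt (2 * pi)) ^ CARD('m)" for x y :: "real^'m"
    by (simp add: std_mvnormal_density_le std_mvnormal_density_nonneg)
  have int: "integrable (\<nu> \<Otimes>\<^sub>M lborel) (\<lambda>(x, y). f y * ?k x y)"
  proof (rule Bochner_Integration.integrable_bound)
    show "integrable (\<nu> \<Otimes>\<^sub>M lborel) (\<lambda>(x, y). (1 / sqrt (2 * pi)) ^ CARD('m) * f y)"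
      using int_f by (intro P.Fubini_integrable) (auto simp: split_beta')
    show "AE p in \<nu> \<Otimes>\<^sub>M lborel. norm (case p of (x, y) \<Rightarrow> f y * ?k x y)
        \<le> norm (case p of (x, y) \<Rightarrow> (1 / sqrt (2 * pi)) ^ CARD('m) * f y)"
    proof (rule AE_I2, clarify)
      fix x y :: "real^'m"
      show "norm (f y * ?k x y) \<le> norm ((1 / sqrt (2 * pi)) ^ CARD('m) * f y)"
        using mult_left_mono[OF k_le[of y x], of "\<bar>f y\<bar>"] by (simp add: abs_mult mult.commute)
    qed
  qed measurable
  have "(\<integral>x. (\<integral>w. f (x + \<epsilon> *\<^sub>R w) \<partial>std_mvnormal) \<partial>\<nu>)
      = (\<integral>x. \<integral>y. f y * ?k x y \<partial>lborel \<partial>\<nu>) / \<epsilon> ^ CARD('m)"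
    by (simp add: Gaussian_smoothing_eq[OF f \<epsilon>])
  also have "(\<integral>x. \<integral>y. f y * ?k x y \<partial>lborel \<partial>\<nu>) = (\<integral>y. \<integral>x. f y * ?k x y \<partial>\<nu> \<partial>lborel)"
    using P.Fubini_integral[OF int] by simp
  also have "complex_of_real (\<dots> / \<epsilon> ^ CARD('m)) =
      (CLINT y|lborel. f y * complex_of_real (\<integral>x. ?k x y \<partial>\<nu>)) / complex_of_real (\<epsilon> ^ CARD('m))"
    by (simp flip: integral_complex_of_real)
  also have "\<dots> = complex_of_real ((1 / sqrt (2 * pi)) ^ CARD('m) / \<epsilon> ^ CARD('m)) *
        (CLINT y|lborel. f y * (CLINT w|std_mvnormal. iexp ((y /\<^sub>R \<epsilon>) \<bullet> w) * char_vec \<nu> (- (w /\<^sub>R \<epsilon>))))"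
    unfolding integral_Gaussian_kernel[OF \<nu> \<epsilon>]
    by (simp add: mult.left_commute[of "complex_of_real (f _)"])
  finally show ?thesis .
qed

lemma integral_Gaussian_smoothing_tendsto:
  fixes \<nu> :: "nat \<Rightarrow> (real^'m) measure" and f :: "real^'m \<Rightarrow> real"
  assumes \<nu>: "\<And>n. borel_prob (\<nu> n)" and \<mu>: "borel_prob \<mu>"
    and char: "\<And>t. (\<lambda>n. char_vec (\<nu> n) t) \<longlonglongrightarrow> char_vec \<mu> t"
    and \<epsilon>: "\<epsilon> > 0"
    and f [measurable]: "f \<in> borel_measurable borel" and int_f: "integrable lborel f"
  shows "(\<lambda>n. \<integral>x. (\<integral>w. f (x + \<epsilon> *\<^sub>R w) \<partial>std_mvnormal) \<partial>\<nu> n)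
    \<longlonglongrightarrow> (\<integral>x. (\<integral>w. f (x + \<epsilon> *\<^sub>R w) \<partial>std_mvnormal) \<partial>\<mu>)"
proof -
  note [measurable] = char_vec_measurable[OF \<nu>] char_vec_measurable[OF \<mu>]
  let ?I = "\<lambda>\<nu> y. CLINT w|std_mvnormal. iexp ((y /\<^sub>R \<epsilon>) \<bullet> w) * char_vec \<nu> (- (w /\<^sub>R \<epsilon>))"
  have I_meas: "?I \<kappa> \<in> borel_measurable borel" if "borel_prob \<kappa>" for \<kappa> :: "(real^'m) measure"
  proof -
    note [measurable] = char_vec_measurable[OF that]
    show ?thesis by measurable
  qed
  note [measurable] = I_meas[OF \<nu>] I_meas[OF \<mu>]
  have I_le: "norm (?I \<kappa> y) \<le> 1" if "borel_prob \<kappa>" for \<kappa> :: "(real^'m) measure" and y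
  proof -
    note [measurable] = char_vec_measurable[OF that]
    have "norm (?I \<kappa> y) \<le> (\<integral>w. norm (iexp ((y /\<^sub>R \<epsilon>) \<bullet> w) * char_vec \<kappa> (- (w /\<^sub>R \<epsilon>))) \<partial>std_mvnormal)"
      by (rule integral_norm_bound)
    also have "\<dots> \<le> (\<integral>w. 1 \<partial>(std_mvnormal :: (real^'m) measure))"
      using norm_char_vec_le[OF that]
      by (intro integral_mono std_mvnormal.integrable_const_bound[of _ 1]) (auto simp: norm_mult)
    finally show ?thesis by simp
  qed
  have I_lim: "(\<lambda>n. ?I (\<nu> n) y) \<longlonglongrightarrow> ?I \<mu> y" for y
    by (rule integral_dominated_convergence[where w="\<lambda>_. 1"])
       (auto intro!: tendsto_mult_left char simp: norm_mult norm_char_vec_le[OF \<nu>])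
  have "(\<lambda>n. CLINT y|lborel. f y * ?I (\<nu> n) y) \<longlonglongrightarrow> (CLINT y|lborel. f y * ?I \<mu> y)"
  proof (rule integral_dominated_convergence[where w="\<lambda>y. \<bar>f y\<bar>"])
    show "AE y in lborel. (\<lambda>n. complex_of_real (f y) * ?I (\<nu> n) y) \<longlonglongrightarrow> f y * ?I \<mu> y"
      by (intro AE_I2 tendsto_mult_left I_lim)
    show "AE y in lborel. norm (complex_of_real (f y) * ?I (\<nu> n) y) \<le> \<bar>f y\<bar>" for n
      unfolding norm_mult norm_of_real by (intro AE_I2 mult_left_le I_le \<nu>) auto
  qed (use int_f in auto)
  then have "(\<lambda>n. complex_of_real (\<integral>x. (\<integral>w. f (x + \<epsilon> *\<^sub>R w) \<partial>std_mvnormal) \<partial>\<nu> n))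
    \<longlonglongrightarrow> complex_of_real (\<integral>x. (\<integral>w. f (x + \<epsilon> *\<^sub>R w) \<partial>std_mvnormal) \<partial>\<mu>)"
    unfolding integral_Gaussian_smoothing[OF \<nu> \<epsilon> f int_f] integral_Gaussian_smoothing[OF \<mu> \<epsilon> f int_f]
    by (rule tendsto_mult_left)
  then show ?thesis by (simp add: tendsto_of_real_iff)
qed


lemma borel_prob_tight:
  fixes \<nu> :: "(real^'m) measure"
  assumes \<nu>: "borel_prob \<nu>" and \<delta>: "\<delta> > 0"
  obtains K where "K > 0" "measure \<nu> (- cball 0 K) < \<delta>"
proof -
  interpret prob_space \<nu> using \<nu> by (rule borel_probD)
  have sets_nu [measurable_cong]: "sets \<nu> = sets borel" using \<nu> by (rule borel_probD)
  have "(\<lambda>n. measure \<nu> (cball 0 (real n))) \<longlonglongrightarrow> measure \<nu> (\<Union>n. cball 0 (real n))"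
    by (rule finite_Lim_measure_incseq) (auto simp: sets_nu incseq_def)
  also have "(\<Union>n. cball 0 (real n)) = (UNIV :: (real^'m) set)"
    by (auto intro: real_arch_simple)
  also have "measure \<nu> UNIV = 1"
    using prob_space borel_probD(3)[OF \<nu>] by simp
  finally have "eventually (\<lambda>n. 1 - \<delta> < measure \<nu> (cball 0 (real n))) sequentially"
    using \<delta> by (intro order_tendstoD) auto
  then obtain n0 where n0: "\<And>n. n \<ge> n0 \<Longrightarrow> 1 - \<delta> < measure \<nu> (cball 0 (real n))"
    by (auto simp: eventually_sequentially)
  show thesis
  proof
    show "0 < real (Suc n0)" by simp
    have "measure \<nu> (- cball 0 (real (Suc n0))) = 1 - measure \<nu> (cball 0 (real (Suc n0)))"
      using prob_compl[of "cball 0 (real (Suc n0))"] borel_probD(3)[OF \<nu>]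
      by (simp add: sets_nu Compl_eq_Diff_UNIV)
    then show "measure \<nu> (- cball 0 (real (Suc n0))) < \<delta>"
      using n0[of "Suc n0"] by simp
  qed
qed

text \<open>
  Two points at distance less than \<open>1\<close> lie both in the ball of radius \<open>R + 1\<close>, which is compact, or
  both outside the support.
\<close>

lemma compact_support_uniformly_continuous:
  fixes f :: "real^'m \<Rightarrow> real"
  assumes cont: "continuous_on UNIV f" and supp: "\<And>x. norm x > R \<Longrightarrow> f x = 0" and e: "e > 0"
  obtains d where "d > 0" "\<And>x y. dist x y < d \<Longrightarrow> \<bar>f x - f y\<bar> < e"
proof -
  have "uniformly_continuous_on (cball 0 (R + 1)) f"
    using cont by (intro compact_uniformly_continuous) (auto intro: continuous_on_subset)
  then obtain d where d: "d > 0"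
    "\<And>x y. x \<in> cball 0 (R + 1) \<Longrightarrow> y \<in> cball 0 (R + 1) \<Longrightarrow> dist x y < d \<Longrightarrow> dist (f x) (f y) < e"
    using e by (auto simp: uniformly_continuous_on_def)
  show thesis
  proof (rule that[of "min d 1"])
    fix x y :: "real^'m" assume xy: "dist x y < min d 1"
    have "\<bar>norm x - norm y\<bar> < 1"
      using xy norm_triangle_ineq3[of x y] by (simp add: dist_norm)
    then consider "norm x \<le> R + 1" "norm y \<le> R + 1" | "norm x > R" "norm y > R"
      by linarith
    then show "\<bar>f x - f y\<bar> < e"
    proof cases
      case 1 then show ?thesis using d(2)[of x y] xy by (simp add: dist_real_def)
    next
      case 2 then show ?thesis using supp e by simp
    qed
  qed (use d in auto)
qed

lemma compact_support_bounded:
  fixes f :: "real^'m \<Rightarrow> real"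
  assumes cont: "continuous_on UNIV f" and supp: "\<And>x. norm x > R \<Longrightarrow> f x = 0"
  obtains B where "B > 0" "\<And>x. \<bar>f x\<bar> \<le> B"
proof -
  have "bounded (f ` cball 0 R)"
    using cont by (intro compact_imp_bounded compact_continuous_image) (auto intro: continuous_on_subset)
  then obtain B where B: "B > 0" "\<And>x. x \<in> cball 0 R \<Longrightarrow> \<bar>f x\<bar> \<le> B"
    by (auto simp: bounded_pos)
  have "\<bar>f x\<bar> \<le> B" for x
    using B supp[of x] by (cases "norm x \<le> R") auto
  then show thesis using that B(1) by blast
qed

text \<open>
  A continuous function of compact support is uniformly continuous, so adding the noise \<open>\<epsilon> W\<close> changes
  its mean value little: \<open>\<epsilon> W\<close> is short except on an event of small probability. Uniformity in \<open>x\<close> is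
  what allows the estimate to be integrated against all the laws of a sequence at once.
\<close>

lemma Gaussian_smoothing_uniformly_close:
  fixes f :: "real^'m \<Rightarrow> real"
  assumes cont: "continuous_on UNIV f" and supp: "\<And>x. norm x > R \<Longrightarrow> f x = 0" and e: "e > 0"
  obtains \<epsilon> where "\<epsilon> > 0" "\<And>x. \<bar>(\<integral>w. f (x + \<epsilon> *\<^sub>R w) \<partial>std_mvnormal) - f x\<bar> \<le> e"
proof -
  have f [measurable]: "f \<in> borel_measurable borel"
    using cont by (rule borel_measurable_continuous_onI)
  obtain B where B: "B > 0" "\<And>x. \<bar>f x\<bar> \<le> B"
    using compact_support_bounded[OF cont supp] by blast
  obtain d where d: "d > 0" "\<And>x y. dist x y < d \<Longrightarrow> \<bar>f x - f y\<bar> < e / 2"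
    using compact_support_uniformly_continuous[OF cont supp, of R "e / 2"] e by auto
  have std: "borel_prob (std_mvnormal :: (real^'m) measure)"
    by (simp add: borel_prob_def prob_space_std_mvnormal)
  obtain K where K: "K > 0" "measure (std_mvnormal :: (real^'m) measure) (- cball 0 K) < e / (4 * B)"
    using borel_prob_tight[OF std, of "e / (4 * B)"] e B by auto
  \<comment> \<open>With this choice \<open>\<parallel>w\<parallel> \<le> K\<close> implies \<open>\<parallel>\<epsilon> w\<parallel> < d\<close>.\<close>
  define \<epsilon> where "\<epsilon> = d / (K + 1)"
  have \<epsilon>: "\<epsilon> > 0" using d K by (simp add: \<epsilon>_def)
  have pointwise: "\<bar>f (x + \<epsilon> *\<^sub>R w) - f x\<bar> \<le> e / 2 + 2 * B * indicator (- cball 0 K) w" for x w :: "real^'m"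
  proof (cases "norm w \<le> K")
    case True
    have "dist (x + \<epsilon> *\<^sub>R w) x = d * (norm w / (K + 1))"
      using d K by (simp add: dist_norm \<epsilon>_def)
    also have "\<dots> < d * 1"
      using True K d by (intro mult_strict_left_mono) auto
    finally show ?thesis using d(2)[of "x + \<epsilon> *\<^sub>R w" x] True by simp
  next
    case False
    then show ?thesis using B(2)[of "x + \<epsilon> *\<^sub>R w"] B(2)[of x] e by simp
  qed
  have int: "integrable std_mvnormal (\<lambda>w. f (x + \<epsilon> *\<^sub>R w))" for x
    using B by (intro std_mvnormal.integrable_const_bound[of _ B]) auto
  have "\<bar>(\<integral>w. f (x + \<epsilon> *\<^sub>R w) \<partial>std_mvnormal) - f x\<bar> \<le> e" for x
  proof -
    have "(\<integral>w. f (x + \<epsilon> *\<^sub>R w) \<partial>std_mvnormal) - f x = (\<integral>w. f (x + \<epsilon> *\<^sub>R w) - f x \<partial>std_mvnormal)"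
      using int by simp
    also have "\<bar>\<dots>\<bar> \<le> (\<integral>w. \<bar>f (x + \<epsilon> *\<^sub>R w) - f x\<bar> \<partial>std_mvnormal)"
      by (rule integral_abs_bound)
    also have "\<dots> \<le> (\<integral>w. e / 2 + 2 * B * indicator (- cball 0 K) w \<partial>(std_mvnormal :: (real^'m) measure))"
      using int by (intro integral_mono pointwise) (auto simp: std_mvnormal.emeasure_eq_measure)
    also have "\<dots> = e / 2 + 2 * B * measure (std_mvnormal :: (real^'m) measure) (- cball 0 K)"
      by (simp add: std_mvnormal.emeasure_eq_measure)
    also have "\<dots> \<le> e / 2 + 2 * B * (e / (4 * B))"
      using K B by (intro add_left_mono mult_left_mono) auto
    also have "\<dots> = e" using B by simp
    finally show ?thesis .
  qed
  then show thesis using that \<epsilon> by blast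
qed

lemma char_vec_tendsto_imp_compact_support_tendsto:
  fixes \<nu> :: "nat \<Rightarrow> (real^'m) measure" and f :: "real^'m \<Rightarrow> real"
  assumes \<nu>: "\<And>n. borel_prob (\<nu> n)" and \<mu>: "borel_prob \<mu>"
    and char: "\<And>t. (\<lambda>n. char_vec (\<nu> n) t) \<longlonglongrightarrow> char_vec \<mu> t"
    and cont: "continuous_on UNIV f" and supp: "\<And>x. norm x > R \<Longrightarrow> f x = 0"
  shows "(\<lambda>n. \<integral>x. f x \<partial>\<nu> n) \<longlonglongrightarrow> (\<integral>x. f x \<partial>\<mu>)"
proof (rule LIMSEQ_I)
  fix r :: real assume r: "r > 0"
  have f [measurable]: "f \<in> borel_measurable borel"
    using cont by (rule borel_measurable_continuous_onI)
  obtain B where B: "B > 0" "\<And>x. \<bar>f x\<bar> \<le> B"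
    using compact_support_bounded[OF cont supp] by blast
  have int_f: "integrable lborel f"
    using supp B by (intro integrableI_bounded_set[of "cball 0 R" _ _ B])
      (auto intro: emeasure_bounded_finite[OF bounded_cball, unfolded infinity_ennreal_def])
  obtain \<epsilon> where \<epsilon>: "\<epsilon> > 0" "\<And>x. \<bar>(\<integral>w. f (x + \<epsilon> *\<^sub>R w) \<partial>std_mvnormal) - f x\<bar> \<le> r / 4"
    using Gaussian_smoothing_uniformly_close[OF cont supp, of R "r / 4"] r by auto
  define g where "g x = (\<integral>w. f (x + \<epsilon> *\<^sub>R w) \<partial>std_mvnormal)" for x
  have g [measurable]: "g \<in> borel_measurable borel"
    unfolding g_def[abs_def] by measurable
  have close: "\<bar>(\<integral>x. g x \<partial>\<kappa>) - (\<integral>x. f x \<partial>\<kappa>)\<bar> \<le> r / 4" if \<kappa>: "borel_prob \<kappa>" for \<kappa>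
  proof -
    interpret prob_space \<kappa> using \<kappa> by (rule borel_probD)
    have [measurable_cong]: "sets \<kappa> = sets borel" using \<kappa> by (rule borel_probD)
    have int: "integrable \<kappa> f" using B by (intro integrable_const_bound[of _ B]) auto
    have int_diff: "integrable \<kappa> (\<lambda>x. g x - f x)"
      using \<epsilon>(2) by (intro integrable_const_bound[of _ "r / 4"]) (auto simp: g_def)
    have "integrable \<kappa> g" using Bochner_Integration.integrable_add[OF int_diff int] by simp
    then have "\<bar>(\<integral>x. g x \<partial>\<kappa>) - (\<integral>x. f x \<partial>\<kappa>)\<bar> = \<bar>\<integral>x. g x - f x \<partial>\<kappa>\<bar>"
      using int by simp
    also have "\<dots> \<le> (\<integral>x. \<bar>g x - f x\<bar> \<partial>\<kappa>)" by (rule integral_abs_bound)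
    also have "\<dots> \<le> (\<integral>x. r / 4 \<partial>\<kappa>)"
      using \<epsilon>(2) int_diff by (intro integral_mono) (auto simp: g_def)
    finally show ?thesis by (simp add: prob_space)
  qed
  have "(\<lambda>n. \<integral>x. g x \<partial>\<nu> n) \<longlonglongrightarrow> (\<integral>x. g x \<partial>\<mu>)"
    unfolding g_def by (rule integral_Gaussian_smoothing_tendsto[OF \<nu> \<mu> char \<epsilon>(1) f int_f])
  then obtain n0 where n0: "\<And>n. n \<ge> n0 \<Longrightarrow> norm ((\<integral>x. g x \<partial>\<nu> n) - (\<integral>x. g x \<partial>\<mu>)) < r / 4"
    using LIMSEQ_D[of _ _ "r / 4"] r by (metis divide_pos_pos zero_less_numeral)
  have "norm ((\<integral>x. f x \<partial>\<nu> n) - (\<integral>x. f x \<partial>\<mu>)) < r" if "n \<ge> n0" for n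
    using n0[OF that] close[OF \<nu>[of n]] close[OF \<mu>] r unfolding real_norm_def by linarith
  then show "\<exists>n0. \<forall>n\<ge>n0. norm ((\<integral>x. f x \<partial>\<nu> n) - (\<integral>x. f x \<partial>\<mu>)) < r"
    by blast
qed

text \<open>
  Test functions of compact support suffice, because no mass escapes: a cutoff function that is
  close to \<open>1\<close> in \<open>\<mu>\<close>-mean is eventually close to \<open>1\<close> in \<open>\<nu> n\<close>-mean, as it has itself
  compact support. Tightness of the sequence is thus a consequence of \<open>\<mu>\<close> being a probability
  measure.
\<close>

theorem char_vec_tendsto_imp_weak_conv_vec:
  fixes \<nu> :: "nat \<Rightarrow> (real^'m) measure"
  assumes \<nu>: "\<And>n. borel_prob (\<nu> n)" and \<mu>: "borel_prob \<mu>"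
    and char: "\<And>t. (\<lambda>n. char_vec (\<nu> n) t) \<longlonglongrightarrow> char_vec \<mu> t"
  shows "weak_conv_vec \<nu> \<mu>"
  unfolding weak_conv_vec_def
proof (intro allI impI, elim conjE)
  fix f :: "real^'m \<Rightarrow> real"
  assume cont: "continuous_on UNIV f" and bdd: "bounded (range f)"
  have f [measurable]: "f \<in> borel_measurable borel"
    using cont by (rule borel_measurable_continuous_onI)
  obtain B where B: "B > 0" "\<And>x. \<bar>f x\<bar> \<le> B"
    using bdd by (auto simp: bounded_pos)
  show "(\<lambda>n. \<integral>x. f x \<partial>\<nu> n) \<longlonglongrightarrow> (\<integral>x. f x \<partial>\<mu>)"
  proof (rule LIMSEQ_I)
    fix r :: real assume r: "r > 0"
    define \<delta> where "\<delta> = r / (4 * B)"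
    have \<delta>: "\<delta> > 0" using r B by (simp add: \<delta>_def)
    obtain R where R: "R > 0" "measure \<mu> (- cball 0 R) < \<delta>"
      using borel_prob_tight[OF \<mu> \<delta>] by blast
    define cut where "cut x = max 0 (min 1 (R + 1 - norm x))" for x :: "real^'m"
    have cut_cont: "continuous_on UNIV cut" unfolding cut_def[abs_def] by (intro continuous_intros)
    have cut [measurable]: "cut \<in> borel_measurable borel"
      using cut_cont by (rule borel_measurable_continuous_onI)
    have cut01: "0 \<le> cut x" "cut x \<le> 1" for x by (auto simp: cut_def)
    have cut_supp: "cut x = 0" if "norm x > R + 1" for x using that by (simp add: cut_def)
    have cutoff: "\<bar>(\<integral>x. f x \<partial>\<kappa>) - (\<integral>x. f x * cut x \<partial>\<kappa>)\<bar> \<le> B * (1 - (\<integral>x. cut x \<partial>\<kappa>))"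
      if \<kappa>: "borel_prob \<kappa>" for \<kappa>
    proof -
      interpret prob_space \<kappa> using \<kappa> by (rule borel_probD)
      have [measurable_cong]: "sets \<kappa> = sets borel" using \<kappa> by (rule borel_probD)
      have int: "integrable \<kappa> f" using B by (intro integrable_const_bound[of _ B]) auto
      have int_cut: "integrable \<kappa> cut" using cut01 by (intro integrable_const_bound[of _ 1]) auto
      have int_fcut: "integrable \<kappa> (\<lambda>x. f x * cut x)"
      proof (intro integrable_const_bound[of _ B] AE_I2)
        fix x
        show "norm (f x * cut x) \<le> B"
          using mult_mono[OF B(2)[of x] cut01(2)[of x]] cut01(1)[of x] B(1) by (simp add: abs_mult)
      qed measurable
      have "\<bar>(\<integral>x. f x \<partial>\<kappa>) - (\<integral>x. f x * cut x \<partial>\<kappa>)\<bar> = \<bar>\<integral>x. f x - f x * cut x \<partial>\<kappa>\<bar>"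
        using int int_fcut by simp
      also have "\<dots> \<le> (\<integral>x. \<bar>f x - f x * cut x\<bar> \<partial>\<kappa>)" by (rule integral_abs_bound)
      also have "\<dots> \<le> (\<integral>x. B * (1 - cut x) \<partial>\<kappa>)"
      proof (rule integral_mono)
        fix x
        have "\<bar>f x - f x * cut x\<bar> = \<bar>f x\<bar> * (1 - cut x)"
          using cut01[of x] abs_mult[of "f x" "1 - cut x"] by (simp add: right_diff_distrib)
        then show "\<bar>f x - f x * cut x\<bar> \<le> B * (1 - cut x)"
          using B(2)[of x] cut01[of x] by (simp add: mult_right_mono)
      qed (use int int_fcut int_cut in auto)
      also have "\<dots> = B * (1 - (\<integral>x. cut x \<partial>\<kappa>))" using int_cut by (simp add: prob_space)
      finally show ?thesis .
    qed
    have cut_\<mu>: "(\<integral>x. cut x \<partial>\<mu>) > 1 - \<delta>"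
    proof -
      interpret prob_space \<mu> using \<mu> by (rule borel_probD)
      have sets_mu [measurable_cong]: "sets \<mu> = sets borel" using \<mu> by (rule borel_probD)
      have "1 - measure \<mu> (- cball 0 R) = (\<integral>x. 1 - indicator (- cball 0 R) x \<partial>\<mu>)"
        by (simp add: prob_space emeasure_eq_measure sets_mu)
      also have "\<dots> \<le> (\<integral>x. cut x \<partial>\<mu>)"
        using cut01 by (intro integral_mono integrable_const_bound[of _ 1] AE_I2)
          (auto simp: cut_def indicator_def)
      finally show ?thesis using R by simp
    qed
    have "(\<lambda>n. \<integral>x. cut x \<partial>\<nu> n) \<longlonglongrightarrow> (\<integral>x. cut x \<partial>\<mu>)"
      by (rule char_vec_tendsto_imp_compact_support_tendsto[OF \<nu> \<mu> char cut_cont cut_supp])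
    then have ev1: "eventually (\<lambda>n. (\<integral>x. cut x \<partial>\<nu> n) > 1 - \<delta>) sequentially"
      using cut_\<mu> by (intro order_tendstoD)
    have "(\<lambda>n. \<integral>x. f x * cut x \<partial>\<nu> n) \<longlonglongrightarrow> (\<integral>x. f x * cut x \<partial>\<mu>)"
      using cut_supp cont cut_cont
      by (intro char_vec_tendsto_imp_compact_support_tendsto[OF \<nu> \<mu> char, of _ "R + 1"]
            continuous_intros) auto
    then have ev2: "eventually (\<lambda>n. dist (\<integral>x. f x * cut x \<partial>\<nu> n) (\<integral>x. f x * cut x \<partial>\<mu>) < r / 4) sequentially"
      using r by (intro tendstoD) auto
    have small: "B * (1 - y) \<le> r / 4" if "y > 1 - \<delta>" for y
    proof -
      have "B * (1 - y) \<le> B * \<delta>" using that B by (intro mult_left_mono) auto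
      then show ?thesis using B by (simp add: \<delta>_def)
    qed
    have "eventually (\<lambda>n. norm ((\<integral>x. f x \<partial>\<nu> n) - (\<integral>x. f x \<partial>\<mu>)) < r) sequentially"
      using ev1 ev2
    proof eventually_elim
      case (elim n)
      show ?case
        using cutoff[OF \<nu>[of n]] cutoff[OF \<mu>] small[OF elim(1)] small[OF cut_\<mu>] elim(2) r
        unfolding real_norm_def dist_real_def by linarith
    qed
    then show "\<exists>n0. \<forall>n\<ge>n0. norm ((\<integral>x. f x \<partial>\<nu> n) - (\<integral>x. f x \<partial>\<mu>)) < r"
      by (simp add: eventually_sequentially)
  qed
qed

text \<open>
  The indicator of an open set is the pointwise limit of the bounded continuous functions
  \<open>min 1 (n dist(x, -U))\<close>, and the open sets generate the Borel sets.
\<close>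

lemma borel_prob_eqI_continuous:
  fixes \<mu> \<nu> :: "'a::metric_space measure"
  assumes \<mu>: "borel_prob \<mu>" and \<nu>: "borel_prob \<nu>"
    and eq: "\<And>f::'a \<Rightarrow> real. continuous_on UNIV f \<Longrightarrow> bounded (range f) \<Longrightarrow>
               (\<integral>x. f x \<partial>\<mu>) = (\<integral>x. f x \<partial>\<nu>)"
  shows "\<mu> = \<nu>"
proof (rule measure_eqI_generator_eq[where E="Collect open" and \<Omega>=UNIV and A="\<lambda>_. UNIV"])
  have sets: "sets \<mu> = sets borel" "sets \<nu> = sets borel"
    using \<mu> \<nu> by (auto simp: borel_prob_def)
  then show "sets \<mu> = sigma_sets UNIV (Collect open)" "sets \<nu> = sigma_sets UNIV (Collect open)"
    by (auto simp: borel_def)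
  show "Int_stable (Collect open :: 'a set set)" by (auto simp: Int_stable_def)
  fix U :: "'a set" assume "U \<in> Collect open"
  then have U: "open U" by simp
  show "emeasure \<mu> U = emeasure \<nu> U"
  \<comment> \<open>The distance to the empty complement is \<open>0\<close> by convention, so the whole space is treated apart.\<close>
  proof (cases "U = UNIV")
    case True
    then show ?thesis
      using \<mu> \<nu> sets_eq_imp_space_eq[OF sets(1)] sets_eq_imp_space_eq[OF sets(2)]
        prob_space.emeasure_space_1[of \<mu>] prob_space.emeasure_space_1[of \<nu>]
      by (simp add: borel_prob_def)
  next
    case False
    define f where "f n x = min 1 (real n * infdist x (- U))" for n x
    have f_cont: "continuous_on UNIV (f n)" for n
      unfolding f_def[abs_def] by (intro continuous_intros)
    have f_bdd: "\<bar>f n x\<bar> \<le> 1" for n x by (auto simp: f_def infdist_nonneg)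
    have f_lim: "(\<lambda>n. f n x) \<longlonglongrightarrow> indicator U x" for x
    proof (cases "x \<in> U")
      case True
      then have pos: "infdist x (- U) > 0"
        using infdist_pos_not_in_closed[of "- U" x] U False by auto
      then obtain n0 :: nat where n0: "1 / infdist x (- U) \<le> real n0"
        using real_arch_simple by blast
      have "f n x = 1" if "n \<ge> n0" for n
      proof -
        have "1 / infdist x (- U) \<le> real n" using n0 that by linarith
        then show ?thesis using pos by (simp add: f_def field_simps min_def)
      qed
      then show ?thesis using True
        by (intro tendsto_eventually) (auto simp: eventually_sequentially)
    next
      case False
      then show ?thesis by (simp add: f_def)
    qed
    have lim: "(\<lambda>n. \<integral>x. f n x \<partial>\<kappa>) \<longlonglongrightarrow> measure \<kappa> U" if \<kappa>: "borel_prob \<kappa>" for \<kappa>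
    proof -
      interpret prob_space \<kappa> using \<kappa> by (simp add: borel_prob_def)
      have sets_k: "sets \<kappa> = sets borel" using \<kappa> by (simp add: borel_prob_def)
      have "f n \<in> borel_measurable \<kappa>" for n
        using borel_measurable_continuous_onI[OF f_cont] measurable_cong_sets[OF sets_k refl] by blast
      moreover have "indicator U \<in> borel_measurable \<kappa>"
        using borel_open[OF U] sets_k by (intro borel_measurable_indicator) auto
      ultimately have "(\<lambda>n. \<integral>x. f n x \<partial>\<kappa>) \<longlonglongrightarrow> (\<integral>x. indicator U x \<partial>\<kappa>)"
        using f_bdd f_lim by (intro integral_dominated_convergence[where w="\<lambda>_. 1"]) auto
      then show ?thesis using U sets_k sets_eq_imp_space_eq[OF sets_k] by simp
    qed
    have "(\<integral>x. f n x \<partial>\<mu>) = (\<integral>x. f n x \<partial>\<nu>)" for n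
      using f_bdd by (intro eq f_cont) (auto intro!: boundedI)
    then have "measure \<mu> U = measure \<nu> U"
      using lim[OF \<mu>] lim[OF \<nu>] LIMSEQ_unique by simp
    then show ?thesis
      using \<mu> \<nu> by (simp add: borel_prob_def prob_space.axioms finite_measure.emeasure_eq_measure)
  qed
qed (use \<mu> in \<open>auto simp: borel_prob_def prob_space.axioms finite_measure.emeasure_eq_measure\<close>)

lemma weak_conv_vec_unique:
  fixes \<nu> :: "nat \<Rightarrow> 'a::metric_space measure"
  assumes "borel_prob \<mu>" "borel_prob \<mu>'" "weak_conv_vec \<nu> \<mu>" "weak_conv_vec \<nu> \<mu>'"
  shows "\<mu> = \<mu>'"
  using assms LIMSEQ_unique unfolding weak_conv_vec_def
  by (intro borel_prob_eqI_continuous) blast+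

text \<open>
  Uniqueness follows from the continuity theorem applied to a constant sequence.
\<close>

corollary char_vec_inject:
  fixes \<mu> \<nu> :: "(real^'m) measure"
  assumes \<mu>: "borel_prob \<mu>" and \<nu>: "borel_prob \<nu>" and eq: "\<And>t. char_vec \<mu> t = char_vec \<nu> t"
  shows "\<mu> = \<nu>"
proof (rule weak_conv_vec_unique[OF \<mu> \<nu>])
  show "weak_conv_vec (\<lambda>_. \<mu>) \<mu>" by (simp add: weak_conv_vec_def)
  show "weak_conv_vec (\<lambda>_. \<mu>) \<nu>"
    using \<mu> \<nu> by (intro char_vec_tendsto_imp_weak_conv_vec) (auto simp: eq)
qed

section \<open>Factorization of covariance matrices\<close>

text \<open>
  The Gram-Schmidt process for the inner product \<open>x \<bullet> S y\<close>, applied to the standard basis.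
  The span condition ensures that the next basis vector is not exhausted by the previous ones.
\<close>

lemma pos_def_sym_orthonormal_family:
  fixes S :: "real^'m^'m"
  assumes S: "pos_def_sym S" and "finite I"
  shows "\<exists>e :: 'm \<Rightarrow> real^'m. (\<forall>i\<in>I. e i \<in> span ((\<lambda>i. axis i 1) ` I)) \<and>
           (\<forall>i\<in>I. \<forall>j\<in>I. e i \<bullet> (S *v e j) = (if i = j then 1 else 0))"
  using \<open>finite I\<close>
proof (induction I)
  case empty
  then show ?case by simp
next
  case (insert k I)
  define ip where "ip x y = x \<bullet> (S *v y)" for x y
  have ip_add: "ip x (y + z) = ip x y + ip x z" and ip_scale: "ip x (c *\<^sub>R y) = c * ip x y"
    and ip_diff: "ip x (y - z) = ip x y - ip x z"
    for x y z c
    by (simp_all add: ip_def matrix_vector_right_distrib matrix_vector_mult_diff_distrib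
        inner_right_distrib inner_diff_right matrix_vector_mult_scaleR)
  have ip_sym: "ip x y = ip y x" for x y
  proof -
    have "ip x y = (transpose S *v x) \<bullet> y"
      by (simp only: ip_def transpose_matrix_vector dot_lmul_matrix)
    also have "\<dots> = ip y x"
      using S by (simp add: ip_def pos_def_sym_def inner_commute)
    finally show ?thesis .
  qed
  have ip_scale_left: "ip (c *\<^sub>R x) y = c * ip x y" for x y c
    by (simp add: ip_def)
  have ip_sum: "ip x (\<Sum>i\<in>J. g i) = (\<Sum>i\<in>J. ip x (g i))" for x g and J :: "'m set"
    by (simp add: ip_def vec.sum inner_sum_right)
  from insert.IH obtain e where span: "\<forall>i\<in>I. e i \<in> span ((\<lambda>i. axis i 1) ` I)"
    and orth: "\<forall>i\<in>I. \<forall>j\<in>I. ip (e i) (e j) = (if i = j then 1 else 0)"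
    by (auto simp: ip_def)
  define u where "u = (\<Sum>i\<in>I. ip (e i) (axis k 1) *\<^sub>R e i)"
  define v where "v = axis k 1 - u"
  have u_span: "u \<in> span ((\<lambda>i. axis i 1) ` I)"
    unfolding u_def using span by (intro span_sum span_scale) auto
  have "axis k 1 \<notin> span ((\<lambda>i. axis i (1::real)) ` I)"
  proof
    assume *: "axis k 1 \<in> span ((\<lambda>i. axis i (1::real)) ` I)"
    have "(\<lambda>i. axis i (1::real)) ` I \<subseteq> Basis - {axis k 1}"
      using insert.hyps(2) by (auto simp: axis_eq_axis)
    then have "axis k (1::real) \<in> span (Basis - {axis k 1})" using * span_mono by blast
    moreover have "axis k (1::real) \<in> Basis" by simp
    ultimately show False using independent_Basis by (auto simp: dependent_def)
  qed
  then have "v \<noteq> 0" using u_span by (auto simp: v_def)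
  then have v_pos: "ip v v > 0" using S by (simp add: pos_def_sym_def ip_def)
  have v_orth: "ip (e j) v = 0" if "j \<in> I" for j
  proof -
    have "ip (e j) u = (\<Sum>i\<in>I. ip (e i) (axis k 1) * (if j = i then 1 else 0))"
      unfolding u_def ip_sum using orth that by (intro sum.cong) (auto simp: ip_scale)
    also have "\<dots> = ip (e j) (axis k 1)"
      using that insert.hyps(1) by (simp add: if_distrib sum.delta cong: if_cong)
    finally show ?thesis by (simp add: v_def ip_diff)
  qed
  define e' where "e' = e(k := v /\<^sub>R sqrt (ip v v))"
  have sub: "span ((\<lambda>i. axis i (1::real)) ` I) \<subseteq> span ((\<lambda>i. axis i 1) ` insert k I)"
    by (intro span_mono) auto
  have "axis k (1::real) \<in> span ((\<lambda>i. axis i 1) ` insert k I)"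
    by (intro span_base) auto
  then have "v \<in> span ((\<lambda>i. axis i 1) ` insert k I)"
    unfolding v_def using u_span sub by (intro span_diff) auto
  then have "e' i \<in> span ((\<lambda>i. axis i 1) ` insert k I)" if "i \<in> insert k I" for i
    using that span sub by (cases "i = k") (auto simp: e'_def intro: span_scale)
  moreover have "ip (e' i) (e' j) = (if i = j then 1 else 0)"
    if ij: "i \<in> insert k I" "j \<in> insert k I" for i j
  proof -
    have "ip (v /\<^sub>R sqrt (ip v v)) (v /\<^sub>R sqrt (ip v v)) = 1"
      using v_pos by (simp add: ip_scale ip_scale_left flip: mult.assoc inverse_mult_distrib)
    moreover have "ip (v /\<^sub>R sqrt (ip v v)) (e l) = 0" "ip (e l) (v /\<^sub>R sqrt (ip v v)) = 0"
      if "l \<in> I" for l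
      using v_orth[OF that] ip_sym[of v "e l"] by (simp_all add: ip_scale ip_scale_left)
    ultimately show ?thesis
      using ij orth insert.hyps(2) by (cases "i = k"; cases "j = k") (simp_all add: e'_def)
  qed
  ultimately show ?case unfolding ip_def by blast
qed

text \<open>
  If \<open>E\<close> has an \<open>S\<close>-orthonormal basis as its columns, then \<open>E\<^sup>T S E = 1\<close>, and \<open>A = S E\<close> satisfies
  \<open>A A\<^sup>T = (S E E\<^sup>T) S = S\<close>.
\<close>

lemma pos_def_sym_factor:
  fixes S :: "real^'m^'m"
  assumes S: "pos_def_sym S"
  obtains A :: "real^'m^'m" where "A ** transpose A = S"
proof -
  obtain e :: "'m \<Rightarrow> real^'m" where e: "\<And>i j. e i \<bullet> (S *v e j) = (if i = j then 1 else 0)"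
    using pos_def_sym_orthonormal_family[OF S, of UNIV] by auto
  define E :: "real^'m^'m" where "E = (\<chi> i j. e j $ i)"
  have "(transpose E ** (S ** E)) $ i $ j = e i \<bullet> (S *v e j)" for i j
    by (simp add: matrix_matrix_mult_def transpose_def inner_vec_def matrix_vector_mult_def E_def)
  then have "transpose E ** (S ** E) = mat 1"
    by (simp add: vec_eq_iff e mat_def)
  then have *: "(S ** E) ** transpose E = mat 1"
    by (simp add: matrix_left_right_inverse)
  have "(S ** E) ** transpose (S ** E) = ((S ** E) ** transpose E) ** transpose S"
    by (simp add: matrix_transpose_mul matrix_mul_assoc)
  also have "\<dots> = S" using S * by (simp add: pos_def_sym_def)
  finally show thesis using that by blast
qed

section \<open>Normal laws and their mixtures\<close>

lemma matrix_vector_mult_measurable [measurable (raw)]: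
  fixes A :: "real^'n^'m"
  assumes "f \<in> borel_measurable M"
  shows "(\<lambda>x. A *v f x) \<in> borel_measurable M"
  using assms borel_measurable_continuous_onI[OF matrix_vector_mult_linear_continuous_on[of UNIV A]]
  by (rule measurable_compose)

lemma borel_prob_distr:
  assumes "prob_space M" "f \<in> borel_measurable M"
  shows "borel_prob (distr M borel f)"
  using assms by (simp add: borel_prob_def prob_space.prob_space_distr)

lemma char_vec_distr:
  fixes f :: "'w \<Rightarrow> real^'m"
  assumes [measurable]: "f \<in> borel_measurable M"
  shows "char_vec (distr M borel f) t = (CLINT x|M. iexp (t \<bullet> f x))"
  unfolding char_vec_def by (rule integral_distr) measurable

lemma char_affine_std_mvnormal:
  fixes A :: "real^'m^'m"
  shows "char_vec (distr std_mvnormal borel (\<lambda>x. c + A *v x)) t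
    = iexp (t \<bullet> c) * exp (- (t \<bullet> ((A ** transpose A) *v t)) / 2)"
proof -
  have "char_vec (distr std_mvnormal borel (\<lambda>x. c + A *v x)) t
      = (CLINT x|std_mvnormal. iexp (t \<bullet> c) * iexp ((transpose A *v t) \<bullet> x))"
    by (subst char_vec_distr)
       (auto simp: inner_add_right dot_lmul_matrix transpose_matrix_vector distrib_left exp_add)
  also have "\<dots> = iexp (t \<bullet> c) * char_vec std_mvnormal (transpose A *v t)"
    unfolding char_vec_def by (rule integral_mult_right_zero)
  also have "(transpose A *v t) \<bullet> (transpose A *v t) = t \<bullet> ((A ** transpose A) *v t)"
    by (simp add: transpose_matrix_vector dot_lmul_matrix flip: matrix_vector_mul_assoc)
  then have "char_vec std_mvnormal (transpose A *v t) = exp (- (t \<bullet> ((A ** transpose A) *v t)) / 2)"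
    by (simp only: char_std_mvnormal)
  finally show ?thesis by simp
qed

lemma borel_prob_affine_std_mvnormal:
  fixes A :: "real^'m^'m"
  shows "borel_prob (distr std_mvnormal borel (\<lambda>x. c + A *v x))"
  by (rule borel_prob_distr[OF prob_space_std_mvnormal]) measurable

text \<open>
  The law of \<open>c + A W\<close> has a characteristic function that involves \<open>A\<close> only through \<open>A A\<^sup>T\<close>, so the
  choice made in the definition of \<open>mvnormal\<close> may be replaced by any convenient factor.
\<close>

lemma mvnormal_eq:
  fixes A :: "real^'m^'m"
  assumes "A ** transpose A = S"
  shows "mvnormal c S = distr std_mvnormal borel (\<lambda>x. c + A *v x)"
proof -
  have "(SOME A :: real^'m^'m. A ** transpose A = S) ** transpose (SOME A :: real^'m^'m. A ** transpose A = S) = S"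
    using assms by (rule someI[where P="\<lambda>A. A ** transpose A = S"])
  then show ?thesis
    unfolding mvnormal_def using assms
    by (intro char_vec_inject borel_prob_affine_std_mvnormal)
       (simp add: char_affine_std_mvnormal)
qed

lemma borel_prob_mvnormal: "borel_prob (mvnormal c S)"
  unfolding mvnormal_def by (rule borel_prob_affine_std_mvnormal)

lemma scaled_factor:
  fixes A :: "real^'m^'m"
  assumes "A ** transpose A = S" "z \<ge> 0"
  shows "(sqrt z *\<^sub>R A) ** transpose (sqrt z *\<^sub>R A) = z *\<^sub>R S"
proof -
  have "(sqrt z *\<^sub>R A) ** transpose (sqrt z *\<^sub>R A) = (sqrt z * sqrt z) *\<^sub>R (A ** transpose A)"
    by (simp only: transpose_scalar matrix_scalar_ac scalar_matrix_assoc scaleR_scaleR)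
  then show ?thesis using assms by simp
qed

lemma char_mvnormal:
  fixes S :: "real^'m^'m"
  assumes "pos_def_sym S" "z \<ge> 0"
  shows "char_vec (mvnormal c (z *\<^sub>R S)) t = iexp (t \<bullet> c) * exp (- z * (t \<bullet> (S *v t)) / 2)"
proof -
  obtain A :: "real^'m^'m" where A: "A ** transpose A = S" using pos_def_sym_factor[OF assms(1)] .
  note A' = scaled_factor[OF A assms(2)]
  have "char_vec (mvnormal c (z *\<^sub>R S)) t = iexp (t \<bullet> c) * exp (- (t \<bullet> ((z *\<^sub>R S) *v t)) / 2)"
    by (simp only: mvnormal_eq[OF A'] char_affine_std_mvnormal A')
  also have "t \<bullet> ((z *\<^sub>R S) *v t) = z * (t \<bullet> (S *v t))"
    by (simp only: scaleR_matrix_vector_assoc[symmetric] inner_scaleR_right)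
  finally show ?thesis by (simp only: mult_minus_left)
qed

text \<open>
  For \<open>z < 0\<close> the choice operator in \<open>mvnormal\<close> selects from the empty set, hence always the same
  matrix. This is what keeps the mixture kernel measurable on the negative half-line.
\<close>

lemma no_factor_negative:
  fixes S :: "real^'m^'m"
  assumes S: "pos_def_sym S" and "z < 0"
  shows "(A :: real^'m^'m) ** transpose A \<noteq> z *\<^sub>R S"
proof
  assume A: "A ** transpose A = z *\<^sub>R S"
  define t :: "real^'m" where "t = axis undefined 1"
  have t: "t \<noteq> 0" by (simp add: t_def axis_eq_0_iff)
  have "0 \<le> (transpose A *v t) \<bullet> (transpose A *v t)" by simp
  also have "\<dots> = t \<bullet> ((A ** transpose A) *v t)"
    by (simp add: transpose_matrix_vector dot_lmul_matrix flip: matrix_vector_mul_assoc)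
  also have "\<dots> = z * (t \<bullet> (S *v t))"
    by (simp add: A scaleR_matrix_vector_assoc[symmetric])
  also have "\<dots> < 0" using assms t by (simp add: pos_def_sym_def mult_neg_pos)
  finally show False by simp
qed

text \<open>
  The factors chosen in \<open>mvnormal\<close> could depend on \<open>z\<close> in a nonmeasurable way. For \<open>z \<ge> 0\<close> they
  may be replaced by \<open>\<surd>z A\<close> with one fixed \<open>A\<close>, and for \<open>z < 0\<close> the choice is constant.
\<close>

lemma mvnormal_kernel_measurable:
  fixes S :: "real^'m^'m"
  assumes S: "pos_def_sym S"
  shows "(\<lambda>z. mvnormal (b + z *\<^sub>R a) (z *\<^sub>R S)) \<in> borel \<rightarrow>\<^sub>M subprob_algebra borel"
proof -
  obtain A :: "real^'m^'m" where A: "A ** transpose A = S" using pos_def_sym_factor[OF S] .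
  define A0 :: "real^'m^'m" where "A0 = (SOME A. False)"
  define f where "f z x = b + z *\<^sub>R a + (if z \<ge> 0 then sqrt z *\<^sub>R (A *v x) else A0 *v x)" for z x
  have "mvnormal (b + z *\<^sub>R a) (z *\<^sub>R S) = distr std_mvnormal borel (f z)" for z
  proof (cases "z \<ge> 0")
    case True
    then show ?thesis
      unfolding mvnormal_eq[OF scaled_factor[OF A True]]
      by (simp add: f_def[abs_def] scaleR_matrix_vector_assoc)
  next
    case False
    then show ?thesis
      using no_factor_negative[OF S, of z]
      by (simp add: mvnormal_def f_def[abs_def] A0_def)
  qed
  moreover have "(\<lambda>z. distr std_mvnormal borel (f z)) \<in> borel \<rightarrow>\<^sub>M subprob_algebra borel"
  proof (rule measurable_distr2)
    show "case_prod f \<in> borel_measurable (borel \<Otimes>\<^sub>M std_mvnormal)"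
      unfolding f_def[abs_def] by measurable
    show "(\<lambda>z. std_mvnormal) \<in> borel \<rightarrow>\<^sub>M subprob_algebra (std_mvnormal :: (real^'m) measure)"
      by (simp add: space_subprob_algebra std_mvnormal.subprob_space_axioms)
  qed
  ultimately show ?thesis by simp
qed

lemma mixing_law_AE_nonneg:
  assumes "mixing_law G"
  shows "AE z in G. 0 \<le> z"
proof -
  interpret real_distribution G using assms by (simp add: mixing_law_def)
  have "{..<0} \<in> null_sets G"
    using assms by (intro null_setsI) (auto simp: mixing_law_def emeasure_eq_measure)
  then show ?thesis by (rule AE_not_in[THEN AE_mp]) auto
qed

lemma borel_prob_mixture:
  assumes S: "pos_def_sym S" and G: "mixing_law G"
  shows "borel_prob (normal_var_mean_mixture b a S G)"
proof -
  interpret real_distribution G using G by (simp add: mixing_law_def)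
  have K: "(\<lambda>z. mvnormal (b + z *\<^sub>R a) (z *\<^sub>R S)) \<in> G \<rightarrow>\<^sub>M subprob_algebra borel"
    using mvnormal_kernel_measurable[OF S] by (simp cong: measurable_cong_sets)
  have "prob_space (normal_var_mean_mixture b a S G)"
    unfolding normal_var_mean_mixture_def
    using borel_prob_mvnormal by (intro prob_space_bind[OF _ K]) (auto simp: borel_prob_def)
  moreover have "sets (normal_var_mean_mixture b a S G) = sets borel"
    unfolding normal_var_mean_mixture_def
    by (rule sets_bind) (use borel_prob_mvnormal in \<open>auto simp: borel_prob_def\<close>)
  ultimately show ?thesis by (simp add: borel_prob_def)
qed

text \<open>
  Integration against a mixture is linear, so it may be checked on the cosine and the sine separately,
  to which the formula for real integrands applies.
\<close>

lemma char_vec_bind: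
  fixes K :: "real \<Rightarrow> (real^'m) measure"
  assumes K [measurable]: "K \<in> G \<rightarrow>\<^sub>M subprob_algebra borel" and "prob_space G"
    and K_prob: "\<And>z. borel_prob (K z)"
  shows "char_vec (G \<bind> K) t = (CLINT z|G. char_vec (K z) t)"
proof -
  interpret prob_space G by fact
  have int: "integrable \<kappa> (\<lambda>x. iexp (t \<bullet> x))" if "borel_prob \<kappa>" for \<kappa> :: "(real^'m) measure"
  proof -
    interpret \<kappa>: prob_space \<kappa> using that by (rule borel_probD)
    have [measurable_cong]: "sets \<kappa> = sets borel" using that by (rule borel_probD)
    show ?thesis by (rule \<kappa>.integrable_const_bound[of _ 1]) auto
  qed
  have bind: "borel_prob (G \<bind> K)"
    unfolding borel_prob_def
  proof
    show "prob_space (G \<bind> K)"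
      using K_prob by (intro prob_space_bind[OF _ K]) (auto simp: borel_prob_def)
    show "sets (G \<bind> K) = sets borel"
      by (rule sets_bind) (use K_prob not_empty in \<open>auto simp: borel_prob_def\<close>)
  qed
  have bind_real: "(\<integral>x. f x \<partial>(G \<bind> K)) = (\<integral>z. \<integral>x. f x \<partial>K z \<partial>G)"
    and int_real: "integrable G (\<lambda>z. \<integral>x. f x \<partial>K z)"
    if f [measurable]: "f \<in> borel_measurable borel" and le: "\<And>x. \<bar>f x\<bar> \<le> 1" for f :: "real^'m \<Rightarrow> real"
  proof -
    have "AE z in G. emeasure (K z) (space (K z)) \<le> ennreal 1"
      using K_prob by (auto simp: borel_prob_def prob_space.emeasure_space_1)
    then show "(\<integral>x. f x \<partial>(G \<bind> K)) = (\<integral>z. \<integral>x. f x \<partial>K z \<partial>G)"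
      using le by (intro integral_bind[OF f _ K finite_measure_axioms, of 1 1]) auto
    show "integrable G (\<lambda>z. \<integral>x. f x \<partial>K z)"
    proof (rule integrable_const_bound[of _ 1])
      show "AE z in G. norm (\<integral>x. f x \<partial>K z) \<le> 1"
      proof (rule AE_I2)
        fix z
        interpret Kz: prob_space "K z" using K_prob by (rule borel_probD)
        have "f \<in> borel_measurable (K z)"
          using f measurable_cong_sets[OF borel_probD(2)[OF K_prob] refl] by blast
        then have "integrable (K z) f" using le by (intro Kz.integrable_const_bound[of _ 1]) auto
        then have "\<bar>\<integral>x. f x \<partial>K z\<bar> \<le> (\<integral>x. 1 \<partial>K z)"
          using le by (intro order_trans[OF integral_abs_bound] integral_mono) auto
        then show "norm (\<integral>x. f x \<partial>K z) \<le> 1" by (simp add: Kz.prob_space)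
      qed
      show "(\<lambda>z. \<integral>x. f x \<partial>K z) \<in> borel_measurable G"
        by (rule measurable_compose[OF K integral_measurable_subprob_algebra]) measurable
    qed
  qed
  have parts: "char_vec \<kappa> t = Complex (\<integral>x. cos (t \<bullet> x) \<partial>\<kappa>) (\<integral>x. sin (t \<bullet> x) \<partial>\<kappa>)"
    if "borel_prob \<kappa>" for \<kappa>
    unfolding char_vec_def using integral_Re[OF int[OF that]] integral_Im[OF int[OF that]]
    by (simp add: complex_eq_iff Re_exp Im_exp)
  have c: "(\<lambda>x. cos (t \<bullet> x)) \<in> borel_measurable borel" and s: "(\<lambda>x. sin (t \<bullet> x)) \<in> borel_measurable borel"
    by measurable
  have "(CLINT z|G. char_vec (K z) t)
      = (CLINT z|G. complex_of_real (\<integral>x. cos (t \<bullet> x) \<partial>K z) + \<i> * complex_of_real (\<integral>x. sin (t \<bullet> x) \<partial>K z))"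
    by (simp add: parts[OF K_prob] Complex_eq)
  also have "\<dots> = complex_of_real (\<integral>z. \<integral>x. cos (t \<bullet> x) \<partial>K z \<partial>G) + \<i> * complex_of_real (\<integral>z. \<integral>x. sin (t \<bullet> x) \<partial>K z \<partial>G)"
    using int_real[OF c] int_real[OF s] by simp
  also have "\<dots> = char_vec (G \<bind> K) t"
    using bind_real[OF c] bind_real[OF s] by (simp add: parts[OF bind] Complex_eq)
  finally show ?thesis ..
qed

lemma char_mixture:
  assumes S: "pos_def_sym S" and G: "mixing_law G"
  shows "char_vec (normal_var_mean_mixture b a S G) t
    = (CLINT z|G. exp (\<i> * (t \<bullet> (b + z *\<^sub>R a)) - z * (t \<bullet> (S *v t)) / 2))"
proof -
  interpret real_distribution G using G by (simp add: mixing_law_def)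
  have K: "(\<lambda>z. mvnormal (b + z *\<^sub>R a) (z *\<^sub>R S)) \<in> G \<rightarrow>\<^sub>M subprob_algebra borel"
    using mvnormal_kernel_measurable[OF S] by (simp cong: measurable_cong_sets)
  have "char_vec (normal_var_mean_mixture b a S G) t
      = (CLINT z|G. char_vec (mvnormal (b + z *\<^sub>R a) (z *\<^sub>R S)) t)"
    unfolding normal_var_mean_mixture_def
    by (rule char_vec_bind[OF K prob_space_axioms borel_prob_mvnormal])
  also have "\<dots> = (CLINT z|G. exp (\<i> * (t \<bullet> (b + z *\<^sub>R a)) - z * (t \<bullet> (S *v t)) / 2))"
  proof (rule integral_cong_AE)
    show "AE z in G. char_vec (mvnormal (b + z *\<^sub>R a) (z *\<^sub>R S)) t
        = exp (\<i> * (t \<bullet> (b + z *\<^sub>R a)) - z * (t \<bullet> (S *v t)) / 2)"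
      using mixing_law_AE_nonneg[OF G]
    proof eventually_elim
      case (elim z)
      then show ?case
        by (simp only: char_mvnormal[OF S elim] exp_of_real[symmetric] exp_add[symmetric]) simp
    qed
    show "(\<lambda>z. char_vec (mvnormal (b + z *\<^sub>R a) (z *\<^sub>R S)) t) \<in> borel_measurable G"
      unfolding char_vec_def
      by (rule measurable_compose[OF K integral_measurable_subprob_algebra]) measurable
  qed measurable
  finally show ?thesis .
qed

section \<open>Identifiability of the mixing law\<close>

definition laplace :: "real measure \<Rightarrow> complex \<Rightarrow> complex" where
  "laplace G s = (CLINT z|G. exp (- (s * of_real z)))"

lemma square_mult_exp_le:
  fixes z c :: real
  assumes "c > 0" "z \<ge> 0"
  shows "z\<^sup>2 * exp (- (c * z)) \<le> 2 / c\<^sup>2"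
proof -
  have "(c * z)\<^sup>2 / 2 \<le> exp (c * z)"
    using exp_lower_Taylor_quadratic[of "c * z"] mult_nonneg_nonneg[of c z] assms by linarith
  then have "(c * z)\<^sup>2 * exp (- (c * z)) \<le> 2 * (exp (c * z) * exp (- (c * z)))"
    using mult_right_mono[of "(c * z)\<^sup>2" "2 * exp (c * z)" "exp (- (c * z))"] by simp
  also have "exp (c * z) * exp (- (c * z)) = 1" by (simp flip: exp_add)
  finally show ?thesis using assms by (simp add: field_simps power_mult_distrib)
qed

text \<open>
  The Taylor remainder of the exponential function grows at most like \<open>z\<^sup>2 exp(\<bar>h\<bar> z)\<close>. For \<open>\<bar>h\<bar> \<le> \<rho> / 2\<close> half
  of the decay \<open>exp(-\<rho> z)\<close> absorbs this growth, and the other half absorbs the square.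
\<close>

lemma norm_exp_diff_quotient_le:
  fixes s h :: complex and z :: real
  assumes z: "z \<ge> 0" and \<rho>: "Re s = \<rho>" "\<rho> > 0" and h: "norm h \<le> \<rho> / 2"
  shows "norm (exp (- ((s + h) * z)) - exp (- (s * z)) + h * (z * exp (- (s * z)))) \<le> 8 / \<rho>\<^sup>2 * (norm h)\<^sup>2"
proof -
  have "exp (- ((s + h) * z)) = exp (- (s * z)) * exp (- (h * z))"
    by (simp add: algebra_simps flip: exp_add)
  then have "exp (- ((s + h) * z)) - exp (- (s * z)) + h * (z * exp (- (s * z)))
      = exp (- (s * z)) * (exp (- (h * z)) - (\<Sum>k\<le>1. (- (h * z)) ^ k / fact k))"
    by (simp add: algebra_simps)
  also have "norm \<dots> \<le> exp (- (\<rho> * z)) * (exp \<bar>Re (- (h * z))\<bar> * norm (- (h * z)) ^ Suc 1 / fact 1)"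
    unfolding norm_mult using \<rho> by (intro mult_mono Taylor_exp) auto
  also have "\<dots> \<le> exp (- (\<rho> * z)) * (exp (\<rho> / 2 * z) * norm (- (h * z)) ^ Suc 1 / fact 1)"
  proof -
    have "\<bar>Re (- (h * z))\<bar> \<le> norm h * z"
      using abs_Re_le_cmod[of "h * z"] z by (simp add: norm_mult)
    also have "\<dots> \<le> \<rho> / 2 * z" using h z by (rule mult_right_mono)
    finally show ?thesis by (intro mult_left_mono divide_right_mono mult_right_mono) auto
  qed
  also have "\<dots> = (norm h)\<^sup>2 * (z\<^sup>2 * exp (- (\<rho> / 2 * z)))"
  proof -
    have "exp (- (\<rho> * z)) * exp (\<rho> / 2 * z) = exp (- (\<rho> / 2 * z))"
      by (simp flip: exp_add)
    moreover have "norm (- (h * of_real z)) ^ Suc 1 = (norm h)\<^sup>2 * z\<^sup>2"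
      by (simp add: norm_mult power2_eq_square)
    moreover have "exp (- (\<rho> * z)) * (exp (\<rho> / 2 * z) * norm (- (h * z)) ^ Suc 1 / fact 1)
        = (exp (- (\<rho> * z)) * exp (\<rho> / 2 * z)) * norm (- (h * z)) ^ Suc 1" by simp
    ultimately show ?thesis by (simp only: ac_simps)
  qed
  also have "\<dots> \<le> (norm h)\<^sup>2 * (2 / (\<rho> / 2)\<^sup>2)"
    using square_mult_exp_le[of "\<rho> / 2" z] z \<rho> by (intro mult_left_mono) auto
  also have "\<dots> = 8 / \<rho>\<^sup>2 * (norm h)\<^sup>2" using \<rho> by (simp add: field_simps power2_eq_square)
  finally show ?thesis .
qed

lemma integrable_laplace:
  assumes G: "mixing_law G" and s: "Re s \<ge> 0"
  shows "integrable G (\<lambda>z. exp (- (s * of_real z)))"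
proof -
  interpret real_distribution G using G by (simp add: mixing_law_def)
  show ?thesis
  proof (rule integrable_const_bound[of _ 1])
    show "AE z in G. norm (exp (- (s * complex_of_real z))) \<le> 1"
      using mixing_law_AE_nonneg[OF G] by eventually_elim (use s in simp)
  qed measurable
qed

text \<open>
  Differentiation under the integral sign: on the half-plane the remainder of the difference quotient is
  bounded uniformly in \<open>z\<close> by a multiple of \<open>\<bar>h\<bar>\<close>, since \<open>z\<^sup>2 exp(-\<rho> z / 2)\<close> is bounded.
\<close>

lemma laplace_holomorphic:
  assumes G: "mixing_law G"
  shows "laplace G holomorphic_on {s. Re s > 0}"
proof (rule holomorphic_onI)
  interpret real_distribution G using G by (simp add: mixing_law_def)
  fix s :: complex assume "s \<in> {s. Re s > 0}"
  define \<rho> where "\<rho> = Re s"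
  have \<rho>: "Re s = \<rho>" "\<rho> > 0" "Re s > 0" using \<open>s \<in> _\<close> by (auto simp: \<rho>_def)
  define D where "D = - (CLINT z|G. of_real z * exp (- (s * of_real z)))"
  have int: "integrable G (\<lambda>z. exp (- (w * of_real z)))" if "Re w > 0" for w
    using integrable_laplace[OF G, of w] that by simp
  have int_D: "integrable G (\<lambda>z. of_real z * exp (- (s * of_real z)))"
  proof (rule integrable_const_bound[of _ "1 + 2 / \<rho>\<^sup>2"])
    show "AE z in G. norm (of_real z * exp (- (s * of_real z))) \<le> 1 + 2 / \<rho>\<^sup>2"
      using mixing_law_AE_nonneg[OF G]
    proof eventually_elim
      case (elim z)
      have "z \<le> 1 + z\<^sup>2" using zero_le_power2[of "z - 1"] elim by (simp add: power2_diff)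
      then have "z * exp (- (\<rho> * z)) \<le> (1 + z\<^sup>2) * exp (- (\<rho> * z))" by (rule mult_right_mono) simp
      also have "\<dots> \<le> 1 + 2 / \<rho>\<^sup>2"
        unfolding distrib_right using square_mult_exp_le[OF \<rho>(2) elim] \<rho> elim by (intro add_mono) auto
      finally show ?case using elim \<rho> by (simp add: norm_mult)
    qed
  qed measurable
  have bound: "norm (laplace G (s + h) - laplace G s - h * D) \<le> 8 / \<rho>\<^sup>2 * (norm h)\<^sup>2"
    if h: "norm h \<le> \<rho> / 2" for h
  proof -
    have "Re (s + h) > 0" using abs_Re_le_cmod[of h] h \<rho> by simp
    then have int_A: "integrable G (\<lambda>z. exp (- ((s + h) * of_real z)))" by (rule int)
    have int_B: "integrable G (\<lambda>z. exp (- (s * of_real z)))" using \<rho>(3) by (rule int)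
    define R where "R z = exp (- ((s + h) * of_real z)) - exp (- (s * of_real z))
        + h * (of_real z * exp (- (s * of_real z)))" for z :: real
    have int_R: "integrable G R"
      unfolding R_def[abs_def]
      by (intro Bochner_Integration.integrable_add Bochner_Integration.integrable_diff
          integrable_mult_right int_A int_B int_D)
    have "(CLINT z|G. R z) = laplace G (s + h) - laplace G s - h * D"
      unfolding R_def laplace_def D_def
      by (subst Bochner_Integration.integral_add,
          intro Bochner_Integration.integrable_diff int_A int_B,
          intro integrable_mult_right int_D,
          subst Bochner_Integration.integral_diff[OF int_A int_B],
          subst integral_mult_right_zero,
          simp only: mult_minus_right diff_minus_eq_add)
    then have "norm (laplace G (s + h) - laplace G s - h * D) = norm (CLINT z|G. R z)" by (simp only:)
    also have "\<dots> \<le> (\<integral>z. norm (R z) \<partial>G)" by (rule integral_norm_bound)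
    also have "\<dots> \<le> (\<integral>z. 8 / \<rho>\<^sup>2 * (norm h)\<^sup>2 \<partial>G)"
    proof (rule integral_mono_AE)
      show "AE z in G. norm (R z) \<le> 8 / \<rho>\<^sup>2 * (norm h)\<^sup>2"
        using mixing_law_AE_nonneg[OF G] unfolding R_def
        by eventually_elim (rule norm_exp_diff_quotient_le[OF _ \<rho>(1,2) h])
    qed (intro integrable_norm int_R integrable_const)+
    finally show ?thesis using prob_space by simp
  qed
  have "((\<lambda>h. (laplace G (s + h) - laplace G s) / h) \<longlongrightarrow> D) (at 0)"
  proof (rule LIM_zero_cancel, rule Lim_null_comparison)
    show "eventually (\<lambda>h. norm ((laplace G (s + h) - laplace G s) / h - D) \<le> 8 / \<rho>\<^sup>2 * norm h) (at 0)"
      unfolding eventually_at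
    proof (intro exI[of _ "\<rho> / 2"] conjI ballI impI)
      fix h :: complex assume h: "h \<noteq> 0 \<and> dist h 0 < \<rho> / 2"
      then have "(laplace G (s + h) - laplace G s) / h - D = (laplace G (s + h) - laplace G s - h * D) / h"
        by (simp add: field_simps)
      also have "norm \<dots> \<le> 8 / \<rho>\<^sup>2 * (norm h)\<^sup>2 / norm h"
        unfolding norm_divide using bound[of h] h by (intro divide_right_mono) auto
      finally show "norm ((laplace G (s + h) - laplace G s) / h - D) \<le> 8 / \<rho>\<^sup>2 * norm h"
        using h \<rho> by (simp add: power2_eq_square)
    qed (use \<rho> in auto)
    show "((\<lambda>h. 8 / \<rho>\<^sup>2 * norm h) \<longlongrightarrow> 0) (at (0::complex))"
      by (rule tendsto_mult_right_zero[OF tendsto_norm_zero[OF tendsto_ident_at]])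
  qed
  then have "(laplace G has_field_derivative D) (at s)" by (simp add: DERIV_def)
  then have "laplace G field_differentiable at s" by (auto simp: field_differentiable_def)
  then show "laplace G field_differentiable at s within {s. Re s > 0}"
    by (rule field_differentiable_at_within)
qed

text \<open>
  The characteristic function is the boundary value of the Laplace transform on the imaginary axis.
\<close>

lemma char_eq_limit_laplace:
  assumes G: "mixing_law G"
  shows "(\<lambda>n. laplace G (Complex (1 / real (Suc n)) (- \<tau>))) \<longlonglongrightarrow> char G \<tau>"
  unfolding laplace_def char_def
proof (rule integral_dominated_convergence[where w="\<lambda>_. 1"])
  interpret real_distribution G using G by (simp add: mixing_law_def)
  show "(\<lambda>z. iexp (\<tau> * z)) \<in> borel_measurable G" by measurable
  show "(\<lambda>z. exp (- (Complex (1 / real (Suc n)) (- \<tau>) * of_real z))) \<in> borel_measurable G" for n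
    by measurable
  show "integrable G (\<lambda>_. 1::real)" by simp
  show "AE z in G. norm (exp (- (Complex (1 / real (Suc n)) (- \<tau>) * complex_of_real z))) \<le> 1" for n
    using mixing_law_AE_nonneg[OF G] by eventually_elim simp
  have "(\<lambda>n. Complex (1 / real (Suc n)) (- \<tau>)) \<longlonglongrightarrow> Complex 0 (- \<tau>)"
    by (intro tendsto_Complex tendsto_const LIMSEQ_Suc lim_1_over_n)
  then have "(\<lambda>n. exp (- (Complex (1 / real (Suc n)) (- \<tau>) * complex_of_real z)))
      \<longlonglongrightarrow> exp (- (Complex 0 (- \<tau>) * complex_of_real z))" for z
    by (rule tendsto_exp[OF tendsto_minus[OF tendsto_mult_right]])
  moreover have "exp (- (Complex 0 (- \<tau>) * complex_of_real z)) = iexp (\<tau> * z)" for z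
    by (simp add: complex_eq_iff Re_exp Im_exp)
  ultimately show "AE z in G. (\<lambda>n. exp (- (Complex (1 / real (Suc n)) (- \<tau>) * complex_of_real z)))
      \<longlonglongrightarrow> iexp (\<tau> * z)" by simp
qed

text \<open>
  The identity theorem extends the equality of the transforms from \<open>U\<close> to the whole half-plane; its boundary
  values give equal characteristic functions.
\<close>

lemma mixing_law_eqI_laplace:
  assumes G: "mixing_law G" "mixing_law G'" and \<xi>: "Re \<xi> > 0" "\<xi> islimpt U"
    and U: "U \<subseteq> {s. Re s > 0}" "\<And>s. s \<in> U \<Longrightarrow> laplace G s = laplace G' s"
  shows "G = G'"
proof (rule Levy_uniqueness)
  have eq: "laplace G s = laplace G' s" if "Re s > 0" for s
  proof -
    have "laplace G s - laplace G' s = 0"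
    proof (rule analytic_continuation[where S="{s. Re s > 0}" and U=U and \<xi>=\<xi>
          and f="\<lambda>s. laplace G s - laplace G' s"])
      show "(\<lambda>s. laplace G s - laplace G' s) holomorphic_on {s. Re s > 0}"
        by (intro holomorphic_intros laplace_holomorphic G)
      show "connected {s. Re s > 0}" by (intro convex_connected convex_halfspace_Re_gt)
    qed (use \<xi> U that in \<open>auto simp: open_halfspace_Re_gt\<close>)
    then show ?thesis by simp
  qed
  show "char G = char G'"
  proof
    fix \<tau>
    have "(\<lambda>n. laplace G' (Complex (1 / real (Suc n)) (- \<tau>))) \<longlonglongrightarrow> char G \<tau>"
      using char_eq_limit_laplace[OF G(1)] by (simp add: eq)
    then show "char G \<tau> = char G' \<tau>"
      using char_eq_limit_laplace[OF G(2)] by (rule LIMSEQ_unique)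
  qed
qed (use G in \<open>auto simp: mixing_law_def\<close>)

lemma char_mixture_laplace:
  assumes S: "pos_def_sym S" and G: "mixing_law G"
  shows "char_vec (normal_var_mean_mixture b a S G) t
    = iexp (t \<bullet> b) * laplace G (Complex ((t \<bullet> (S *v t)) / 2) (- (t \<bullet> a)))"
proof -
  have "exp (\<i> * (t \<bullet> (b + z *\<^sub>R a)) - z * (t \<bullet> (S *v t)) / 2)
      = iexp (t \<bullet> b) * exp (- (Complex ((t \<bullet> (S *v t)) / 2) (- (t \<bullet> a)) * of_real z))" for z
    unfolding exp_add[symmetric]
    by (rule arg_cong[of _ _ exp]) (simp add: complex_eq_iff inner_add_right algebra_simps)
  then show ?thesis by (simp add: char_mixture[OF S G] laplace_def)
qed

text \<open>
  Along a ray \<open>r t\<^sub>0\<close>, \<open>r > 0\<close>, the Laplace transform is known at \<open>r\<^sup>2 q / 2 - i r t\<^sub>0\<cdot>a\<close>. These points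
  form the positive real axis if \<open>t\<^sub>0\<cdot>a = 0\<close> and half a parabola otherwise. In either case they accumulate
  inside the half-plane: the curve is continuous, and its real part is strictly increasing in \<open>r\<close>.
\<close>

theorem mixture_inject:
  assumes S: "pos_def_sym S" and G: "mixing_law G" "mixing_law G'"
    and eq: "normal_var_mean_mixture b a S G = normal_var_mean_mixture b a S G'"
  shows "G = G'"
proof -
  define s where "s t = Complex ((t \<bullet> (S *v t)) / 2) (- (t \<bullet> a))" for t
  have laplace_eq: "laplace G (s t) = laplace G' (s t)" for t
    using arg_cong[OF eq, of "\<lambda>F. char_vec F t"]
    by (simp add: char_mixture_laplace[OF S G(1)] char_mixture_laplace[OF S G(2)] s_def)
  define t0 :: "real^'a" where "t0 = axis undefined 1"
  define q where "q = t0 \<bullet> (S *v t0)"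
  have "t0 \<noteq> 0" by (simp add: t0_def axis_eq_0_iff)
  then have q: "q > 0" using S by (simp add: q_def pos_def_sym_def)
  define U where "U = {s (r *\<^sub>R t0) | r. r > 0}"
  have s_eq: "s (r *\<^sub>R t0) = Complex (r\<^sup>2 * q / 2) (- (r * (t0 \<bullet> a)))" for r
    by (simp add: s_def q_def matrix_vector_mult_scaleR power2_eq_square)
  show ?thesis
  proof (rule mixing_law_eqI_laplace[OF G])
    show "Re (s t0) > 0" using q by (simp add: s_def q_def)
    show "U \<subseteq> {s. 0 < Re s}" using q by (auto simp: U_def s_eq)
    show "s t0 islimpt U"
      unfolding islimpt_sequential
    proof (intro exI conjI allI)
      define r where "r n = 1 + 1 / real (Suc n)" for n
      have r: "r n > 0" "r n \<noteq> 1" for n by (auto simp: r_def add_pos_pos)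
      have "(r n)\<^sup>2 \<noteq> 1" for n using r[of n] by (simp add: power2_eq_1_iff)
      then have "s (r n *\<^sub>R t0) \<noteq> s t0" for n
        using q s_eq[of 1] by (simp add: s_eq)
      then show "s (r n *\<^sub>R t0) \<in> U - {s t0}" for n
        using r[of n] by (auto simp: U_def)
      have "r \<longlonglongrightarrow> 1 + 0"
        unfolding r_def[abs_def] by (intro tendsto_add tendsto_const LIMSEQ_Suc lim_1_over_n)
      then have "(\<lambda>n. s (r n *\<^sub>R t0)) \<longlonglongrightarrow> s ((1 + 0) *\<^sub>R t0)"
        unfolding s_eq by (intro tendsto_intros) auto
      then show "(\<lambda>n. s (r n *\<^sub>R t0)) \<longlonglongrightarrow> s t0" by simp
    qed
    show "laplace G w = laplace G' w" if "w \<in> U" for w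
      using that laplace_eq by (auto simp: U_def)
  qed
qed

section \<open>Tightness\<close>

text \<open>
  The converse half of Prokhorov's theorem, for the upper tail. If mass \<open>e\<close> could be found beyond every bound, a weakly
  convergent subsequence of such laws would have a limit whose distribution function stays below
  \<open>1 - e\<close>.
\<close>

lemma weakly_relatively_compact_tail:
  assumes comp: "weakly_relatively_compact \<M>" and real: "\<And>\<mu>. \<mu> \<in> \<M> \<Longrightarrow> real_distribution \<mu>"
    and e: "e > 0"
  obtains K where "K > 0" "\<And>\<mu>. \<mu> \<in> \<M> \<Longrightarrow> measure \<mu> {K<..} < e"
proof (rule ccontr)
  assume "\<not> thesis"
  then have "\<exists>\<mu>\<in>\<M>. measure \<mu> {real k + 1<..} \<ge> e" for k :: nat
    using that[of "real k + 1"] by (force simp: not_less)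
  then obtain \<mu> where \<mu>: "\<And>k. \<mu> k \<in> \<M>" "\<And>k::nat. measure (\<mu> k) {real k + 1<..} \<ge> e"
    by metis
  obtain s \<nu> where s: "strict_mono s" and \<nu>: "real_distribution \<nu>" and conv: "weak_conv_m (\<mu> \<circ> s) \<nu>"
    using comp \<mu>(1) unfolding weakly_relatively_compact_def by blast
  interpret \<nu>: real_distribution \<nu> by (rule \<nu>)
  have "eventually (\<lambda>x. cdf \<nu> x > 1 - e) at_top"
    using \<nu>.cdf_lim_at_top_prob e by (intro order_tendstoD) auto
  then obtain x0 where x0: "\<And>x. x \<ge> x0 \<Longrightarrow> cdf \<nu> x > 1 - e"
    by (auto simp: eventually_at_top_linorder)
  \<comment> \<open>Weak convergence only controls continuity points, which are dense as there are countably many atoms.\<close>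
  obtain x where x: "x \<in> {x0<..<x0 + 1}" "x \<notin> {x. measure \<nu> {x} > 0}"
    using real_interval_avoid_countable_set[of x0 "x0 + 1" "{x. measure \<nu> {x} > 0}"] \<nu>.countable_support
    by (auto simp: zero_less_measure_iff)
  then have "isCont (cdf \<nu>) x" by (simp add: \<nu>.isCont_cdf zero_less_measure_iff)
  then have "(\<lambda>k. cdf (\<mu> (s k)) x) \<longlonglongrightarrow> cdf \<nu> x"
    using conv by (simp add: weak_conv_m_def weak_conv_def)
  moreover have "cdf (\<mu> (s k)) x \<le> 1 - e" if "k \<ge> nat \<lceil>x\<rceil>" for k
  proof -
    interpret \<mu>: real_distribution "\<mu> (s k)" using real \<mu>(1) .
    have "x \<le> real (s k) + 1" using that seq_suble[OF s, of k] by linarith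
    then have "measure (\<mu> (s k)) {real (s k) + 1<..} \<le> measure (\<mu> (s k)) {x<..}"
      by (intro \<mu>.finite_measure_mono) auto
    moreover have "measure (\<mu> (s k)) {x<..} = 1 - cdf (\<mu> (s k)) x"
      using \<mu>.prob_compl[of "{..x}"] by (simp add: cdf_def Compl_eq_Diff_UNIV[symmetric])
    ultimately show ?thesis using \<mu>(2)[of "s k"] by linarith
  qed
  ultimately have "cdf \<nu> x \<le> 1 - e" by (intro LIMSEQ_le_const2) blast+
  then show False using x0[of x] x(1) by simp
qed

section \<open>Conditioning on an independent random index\<close>

text \<open>
  The factorization of an expectation for variables with values in different types, reduced to the
  case in which both are complex-valued.
\<close>

lemma (in prob_space) expectation_indicator_indep:
  fixes g :: "'b::topological_space \<Rightarrow> complex" and N :: "'a \<Rightarrow> nat"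
  assumes indep: "indep_rv M (count_space UNIV) N borel V"
    and g [measurable]: "g \<in> borel_measurable borel" and bdd: "\<And>v. norm (g v) \<le> 1"
  shows "(CLINT \<omega>|M. indicator {k} (N \<omega>) * g (V \<omega>))
    = (CLINT \<omega>|M. indicator {k} (N \<omega>)) * (CLINT \<omega>|M. g (V \<omega>))"
proof (rule indep_var_lebesgue_integral)
  have N [measurable]: "N \<in> M \<rightarrow>\<^sub>M count_space UNIV" and V [measurable]: "V \<in> borel_measurable M"
    and ind: "indep_set {N -` A \<inter> space M | A. A \<in> sets (count_space UNIV)} {V -` B \<inter> space M | B. B \<in> sets borel}"
    using indep by (auto simp: indep_rv_def)
  have meas: "(\<lambda>\<omega>. indicator {k} (N \<omega>) :: complex) \<in> borel_measurable M" "(\<lambda>\<omega>. g (V \<omega>)) \<in> borel_measurable M"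
    by (rule measurable_compose[OF N], simp) (rule measurable_compose[OF V g])
  have "indep_set {(\<lambda>\<omega>. indicator {k} (N \<omega>) :: complex) -` A \<inter> space M | A. A \<in> sets borel}
      {(\<lambda>\<omega>. g (V \<omega>)) -` B \<inter> space M | B. B \<in> sets borel}"
  proof (rule indep_setI)
    fix A' B' assume "A' \<in> {(\<lambda>\<omega>. indicator {k} (N \<omega>) :: complex) -` A \<inter> space M | A. A \<in> sets borel}"
      and "B' \<in> {(\<lambda>\<omega>. g (V \<omega>)) -` B \<inter> space M | B. B \<in> sets borel}"
    then obtain A B where A: "A' = (\<lambda>\<omega>. indicator {k} (N \<omega>) :: complex) -` A \<inter> space M"
      and B: "B' = (\<lambda>\<omega>. g (V \<omega>)) -` B \<inter> space M" "B \<in> sets borel" by blast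
    have "A' = N -` (indicator {k} -` A) \<inter> space M" "B' = V -` (g -` B) \<inter> space M"
      using A B by auto
    moreover have "g -` B \<in> sets borel" using measurable_sets[OF g B(2)] by simp
    ultimately show "prob (A' \<inter> B') = prob A' * prob B'"
      by (intro indep_setD[OF ind]) auto
  next
    show "{(\<lambda>\<omega>. indicator {k} (N \<omega>) :: complex) -` A \<inter> space M | A. A \<in> sets borel} \<subseteq> events"
      using measurable_sets[OF meas(1)] by blast
    show "{(\<lambda>\<omega>. g (V \<omega>)) -` B \<inter> space M | B. B \<in> sets borel} \<subseteq> events"
      using measurable_sets[OF meas(2)] by blast
  qed
  moreover have "Int_stable {f -` A \<inter> space M | A. A \<in> sets borel}" for f :: "'a \<Rightarrow> complex"
  proof (rule Int_stableI)
    fix a b assume "a \<in> {f -` A \<inter> space M | A. A \<in> sets borel}" "b \<in> {f -` A \<inter> space M | A. A \<in> sets borel}"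
    then obtain A B where "a = f -` A \<inter> space M" "A \<in> sets borel" "b = f -` B \<inter> space M" "B \<in> sets borel"
      by blast
    then have "a \<inter> b = f -` (A \<inter> B) \<inter> space M" "A \<inter> B \<in> sets borel" by auto
    then show "a \<inter> b \<in> {f -` A \<inter> space M | A. A \<in> sets borel}" by blast
  qed
  ultimately show "indep_var borel (\<lambda>\<omega>. indicator {k} (N \<omega>)) borel (\<lambda>\<omega>. g (V \<omega>))"
    unfolding indep_var_eq using meas by (intro conjI indep_set_sigma_sets) auto
  show "complex_integrable M (\<lambda>\<omega>. indicator {k} (N \<omega>))"
    by (rule integrable_const_bound[of _ 1]) (auto simp: indicator_def)
  show "complex_integrable M (\<lambda>\<omega>. g (V \<omega>))"
    using bdd by (intro integrable_const_bound[of _ 1]) auto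
qed

text \<open>
  On the event \<open>N = k\<close> the randomly indexed variable is \<open>V k\<close>, which is independent of that event;
  summation over \<open>k\<close> gives the claim. Independence of \<open>N\<close> from each single \<open>V k\<close> is enough, as the sum
  never involves two of them together.
\<close>

lemma (in prob_space) expectation_random_index:
  fixes g :: "'b::topological_space \<Rightarrow> complex" and N :: "'a \<Rightarrow> nat"
  assumes N [measurable]: "N \<in> M \<rightarrow>\<^sub>M count_space UNIV" and N_in: "\<And>\<omega>. \<omega> \<in> space M \<Longrightarrow> N \<omega> \<in> I"
    and indep: "\<And>k. k \<in> I \<Longrightarrow> indep_rv M (count_space UNIV) N borel (V k)"
    and g [measurable]: "g \<in> borel_measurable borel" and bdd: "\<And>v. norm (g v) \<le> 1"
  shows "(CLINT \<omega>|M. g (V (N \<omega>) \<omega>)) = (CLINT \<omega>|M. CLINT \<omega>'|M. g (V (N \<omega>) \<omega>'))"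
proof -
  have V: "V k \<in> borel_measurable M" if "k \<in> I" for k
    using indep[OF that] by (simp add: indep_rv_def)
  have N': "N \<in> M \<rightarrow>\<^sub>M count_space I"
    by (rule measurable_count_space_extend[OF subset_UNIV]) (use N_in in auto)
  define A where "A k = N -` {k} \<inter> space M" for k
  have A: "A k \<in> sets M" for k unfolding A_def by measurable
  have A_Un: "(\<Union>k. A k) = space M" by (auto simp: A_def)
  have split: "(CLINT \<omega>|M. f \<omega>) = (\<Sum>k. CLINT \<omega>|M. indicator {k} (N \<omega>) * f \<omega>)"
    if f: "f \<in> borel_measurable M" "\<And>\<omega>. norm (f \<omega>) \<le> 1" for f :: "'a \<Rightarrow> complex"
  proof -
    have int: "integrable M f" using f by (intro integrable_const_bound[of _ 1]) auto
    then have set_int: "set_integrable M (\<Union>k. A k) f"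
      unfolding A_Un set_integrable_def by (intro integrable_mult_indicator) auto
    have "(CLINT \<omega>:(\<Union>k. A k)|M. f \<omega>) = (\<Sum>k. CLINT \<omega>:(A k)|M. f \<omega>)"
    proof (rule lebesgue_integral_countable_add[OF A _ set_int])
      show "A i \<inter> A j = {}" if "i \<noteq> j" for i j using that by (auto simp: A_def)
    qed
    moreover have "(CLINT \<omega>:(\<Union>k. A k)|M. f \<omega>) = (CLINT \<omega>|M. f \<omega>)"
      by (auto simp: A_Un set_lebesgue_integral_def intro!: Bochner_Integration.integral_cong)
    moreover have "(CLINT \<omega>:(A k)|M. f \<omega>) = (CLINT \<omega>|M. indicator {k} (N \<omega>) * f \<omega>)" for k
      unfolding set_lebesgue_integral_def
      by (intro Bochner_Integration.integral_cong refl) (auto simp: A_def indicator_def)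
    ultimately show ?thesis by simp
  qed
  define \<gamma> where "\<gamma> k = (CLINT \<omega>'|M. g (V k \<omega>'))" for k
  have "norm (\<gamma> k) \<le> 1" for k
  proof (cases "integrable M (\<lambda>\<omega>'. g (V k \<omega>'))")
    case True
    have "norm (\<gamma> k) \<le> (\<integral>\<omega>'. norm (g (V k \<omega>')) \<partial>M)"
      unfolding \<gamma>_def by (rule integral_norm_bound)
    also have "\<dots> \<le> (\<integral>\<omega>'. 1 \<partial>M)"
      using True bdd by (intro integral_mono integrable_norm integrable_const) auto
    finally show ?thesis by (simp add: prob_space)
  qed (simp add: \<gamma>_def not_integrable_integral_eq)
  moreover have "(\<lambda>\<omega>. \<gamma> (N \<omega>)) \<in> borel_measurable M"
    by (rule measurable_compose[OF N]) simp
  ultimately have "(CLINT \<omega>|M. \<gamma> (N \<omega>)) = (\<Sum>k. CLINT \<omega>|M. indicator {k} (N \<omega>) * \<gamma> (N \<omega>))"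
    by (intro split)
  moreover have "(\<lambda>\<omega>. g (V (N \<omega>) \<omega>)) \<in> borel_measurable M"
    by (rule measurable_compose_countable'[OF measurable_compose[OF V g] N']) auto
  then have "(CLINT \<omega>|M. g (V (N \<omega>) \<omega>)) = (\<Sum>k. CLINT \<omega>|M. indicator {k} (N \<omega>) * g (V (N \<omega>) \<omega>))"
    using bdd by (rule split)
  moreover have "(CLINT \<omega>|M. indicator {k} (N \<omega>) * g (V (N \<omega>) \<omega>))
      = (CLINT \<omega>|M. indicator {k} (N \<omega>) * \<gamma> (N \<omega>))" for k
  proof (cases "k \<in> I")
    case True
    have "(CLINT \<omega>|M. indicator {k} (N \<omega>) * g (V (N \<omega>) \<omega>)) = (CLINT \<omega>|M. indicator {k} (N \<omega>) * g (V k \<omega>))"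
      by (intro Bochner_Integration.integral_cong refl) (auto simp: indicator_def)
    also have "\<dots> = (CLINT \<omega>|M. indicator {k} (N \<omega>)) * \<gamma> k"
        unfolding \<gamma>_def by (rule expectation_indicator_indep[OF indep[OF True] g bdd])
    also have "\<dots> = (CLINT \<omega>|M. indicator {k} (N \<omega>) * \<gamma> k)"
      by (rule integral_mult_left_zero[symmetric])
    also have "\<dots> = (CLINT \<omega>|M. indicator {k} (N \<omega>) * \<gamma> (N \<omega>))"
      by (intro Bochner_Integration.integral_cong refl) (auto simp: indicator_def)
    finally show ?thesis .
  next
    case False
    then have "indicator {k} (N \<omega>) = (0::complex)" if "\<omega> \<in> space M" for \<omega>
      using N_in[OF that] by (auto simp: indicator_def)
    then show ?thesis
      by (intro Bochner_Integration.integral_cong refl) simp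
  qed
  ultimately show ?thesis by (simp only: \<gamma>_def)
qed

section \<open>Statistics of random sample size\<close>

lemma norm_iexp_diff_le: "norm (iexp x - iexp y) \<le> \<bar>x - y\<bar>"
proof -
  have "iexp x - iexp y = iexp y * (iexp (x - y) - 1)"
    by (simp add: algebra_simps flip: exp_add)
  then have "norm (iexp x - iexp y) = norm (iexp (x - y) - 1)"
    by (simp add: norm_mult)
  also have "\<dots> \<le> \<bar>x - y\<bar>"
    using iexp_approx1[of "x - y" 0] by simp
  finally show ?thesis .
qed

locale random_sample_size = prob_space M
  for M :: "'w measure"
    and X :: "nat \<Rightarrow> nat \<Rightarrow> 'w \<Rightarrow> 'x"
    and T :: "nat \<Rightarrow> nat \<Rightarrow> (nat \<Rightarrow> 'x) \<Rightarrow> real^'m"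
    and \<theta> a_seq b_seq :: "nat \<Rightarrow> real^'m"
    and a b :: "real^'m"
    and \<sigma> :: "nat \<Rightarrow> real"
    and N :: "nat \<Rightarrow> 'w \<Rightarrow> nat"
    and \<Sigma> :: "real^'m^'m"
    and h :: "nat \<Rightarrow> nat \<Rightarrow> real^'m \<Rightarrow> complex" +
  assumes N_meas: "\<And>n. n \<ge> 1 \<Longrightarrow> N n \<in> measurable M (count_space UNIV)"
    and N_pos: "\<And>n \<omega>. n \<ge> 1 \<Longrightarrow> \<omega> \<in> space M \<Longrightarrow> N n \<omega> \<ge> 1"
    and N_T_indep: "\<And>n k. n \<ge> 1 \<Longrightarrow> k \<ge> 1 \<Longrightarrow>
        indep_rv M (count_space UNIV) (N n) borel (\<lambda>\<omega>. statistic X T n k \<omega> - \<theta> n)"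
    and N_compact: "weakly_relatively_compact
        {distr M borel (\<lambda>\<omega>. real n / real (N n \<omega>)) | n. n \<ge> 1}"
    and \<sigma>_pos: "\<And>n. n \<ge> 1 \<Longrightarrow> \<sigma> n > 0"
    and a_lim: "a_seq \<longlonglongrightarrow> a"
    and b_lim: "b_seq \<longlonglongrightarrow> b"
    and \<Sigma>_pos_def: "pos_def_sym \<Sigma>"
    and h_char: "\<And>n k t. n \<ge> 1 \<Longrightarrow> k \<ge> 1 \<Longrightarrow>
        h n k t = char_vec (distr M borel (normalized_statistic X T \<theta> \<sigma> a_seq n k)) t"
    and asymp_normal: "\<And>\<tau>::real. \<tau> > 0 \<Longrightarrow>
        (\<lambda>n. \<integral>\<omega>. (SUP t\<in>cball 0 \<tau>.
               cmod (h n (N n \<omega>) t - complex_of_real (exp (- (1/2) * (t \<bullet> (\<Sigma> *v t)))))) \<partial>M)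
          \<longlonglongrightarrow> 0"
begin

abbreviation U :: "nat \<Rightarrow> 'w \<Rightarrow> real" where "U n \<omega> \<equiv> real n / real (N n \<omega>)"

abbreviation U_law :: "nat \<Rightarrow> real measure" where "U_law n \<equiv> distr M borel (U n)"

abbreviation Z :: "nat \<Rightarrow> 'w \<Rightarrow> real^'m" where "Z \<equiv> random_size_statistic X T \<theta> \<sigma> b_seq N"

abbreviation Z_law :: "nat \<Rightarrow> (real^'m) measure" where "Z_law n \<equiv> distr M borel (Z n)"

lemma U_measurable [measurable]: "U n \<in> borel_measurable M"
proof (cases "n = 0")
  case False
  then show ?thesis by (intro measurable_compose[OF N_meas, of n "\<lambda>k. real n / real k"]) auto
qed simp

lemma real_distribution_U_law: "real_distribution (U_law n)"
  by (simp add: real_distribution_def real_distribution_axioms_def prob_space_distr)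

lemma deviation_measurable:
  assumes "n \<ge> 1" "k \<ge> 1"
  shows "(\<lambda>\<omega>. statistic X T n k \<omega> - \<theta> n) \<in> borel_measurable M"
  using N_T_indep[OF assms] by (simp add: indep_rv_def)

lemma Z_eq:
  assumes "n \<ge> 1"
  shows "Z n \<omega> = (\<sigma> n * sqrt (real n)) *\<^sub>R (statistic X T n (N n \<omega>) \<omega> - \<theta> n) - b_seq n"
  using assms by (intro random_size_statistic_eq \<sigma>_pos)

lemma N_measurable_pos: "n \<ge> 1 \<Longrightarrow> N n \<in> M \<rightarrow>\<^sub>M count_space {1..}"
  by (rule measurable_count_space_extend[OF subset_UNIV]) (use N_meas N_pos in auto)

lemma Z_measurable [measurable]: "Z n \<in> borel_measurable M"
proof (cases "n = 0")
  case True
  \<comment> \<open>Division by zero yields \<open>outer_scale \<sigma> 0 = 0\<close>, so the term of index \<open>0\<close> is the constant \<open>0\<close>.\<close>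
  then have "Z n = (\<lambda>_. 0)"
    by (simp add: fun_eq_iff random_size_statistic_def outer_scale_def)
  then show ?thesis by simp
next
  case False
  then have n: "n \<ge> 1" by simp
  have "(\<lambda>\<omega>. statistic X T n (N n \<omega>) \<omega> - \<theta> n) \<in> borel_measurable M"
    by (rule measurable_compose_countable'[OF deviation_measurable[OF n] N_measurable_pos[OF n]]) auto
  then show ?thesis
    unfolding Z_eq[OF n, abs_def] by measurable
qed

lemma borel_prob_Z_law: "borel_prob (Z_law n)"
  by (intro borel_prob_distr prob_space_axioms Z_measurable)

lemma Y_eq:
  assumes "n \<ge> 1" "k \<ge> 1"
  shows "normalized_statistic X T \<theta> \<sigma> a_seq n k \<omega>
    = (\<sigma> n * sqrt (real k)) *\<^sub>R (statistic X T n k \<omega> - \<theta> n) - sqrt (real n / real k) *\<^sub>R a_seq n"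
  using assms by (intro normalized_statistic_eq \<sigma>_pos)

lemma normalized_statistic_measurable:
  assumes n: "n \<ge> 1" and k: "k \<ge> 1"
  shows "normalized_statistic X T \<theta> \<sigma> a_seq n k \<in> borel_measurable M"
proof -
  note [measurable] = deviation_measurable[OF n k]
  show ?thesis unfolding Y_eq[OF n k, abs_def] by measurable
qed

text \<open>
  Averaging over the statistic for a frozen sample size turns \<open>iexp (t \<bullet> Z)\<close> into a value of \<open>h\<close>.
\<close>

lemma char_Z_law:
  assumes n: "n \<ge> 1"
  shows "char_vec (Z_law n) t
    = (CLINT \<omega>|M. h n (N n \<omega>) (sqrt (U n \<omega>) *\<^sub>R t) * iexp (U n \<omega> * (t \<bullet> a_seq n) - t \<bullet> b_seq n))"
proof -
  define g where "g v = iexp (t \<bullet> ((\<sigma> n * sqrt (real n)) *\<^sub>R v - b_seq n))" for v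
  have g [measurable]: "g \<in> borel_measurable borel" unfolding g_def by measurable
  have g_le: "norm (g v) \<le> 1" for v by (simp add: g_def)
  have "char_vec (Z_law n) t = (CLINT \<omega>|M. g (statistic X T n (N n \<omega>) \<omega> - \<theta> n))"
    by (simp only: char_vec_distr[OF Z_measurable] Z_eq[OF n] g_def)
  also have "\<dots> = (CLINT \<omega>|M. CLINT \<omega>'|M. g (statistic X T n (N n \<omega>) \<omega>' - \<theta> n))"
    by (rule expectation_random_index[where I="{1..}" and V="\<lambda>k \<omega>. statistic X T n k \<omega> - \<theta> n",
          OF N_meas[OF n] _ N_T_indep[OF n] g g_le]) (use N_pos[OF n] in auto)
  also have "\<dots> = (CLINT \<omega>|M. h n (N n \<omega>) (sqrt (U n \<omega>) *\<^sub>R t) * iexp (U n \<omega> * (t \<bullet> a_seq n) - t \<bullet> b_seq n))"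
  proof (rule Bochner_Integration.integral_cong[OF refl])
    fix \<omega> assume "\<omega> \<in> space M"
    then have k: "N n \<omega> \<ge> 1" using N_pos[OF n] by simp
    define k where "k = N n \<omega>"
    define u where "u = real n / real k"
    \<comment> \<open>For a fixed sample size \<open>k\<close> the two normalizations differ by the factor \<open>\<surd>u\<close> and by a shift.\<close>
    let ?Y = "normalized_statistic X T \<theta> \<sigma> a_seq n k"
    have k1: "k \<ge> 1" using k by (simp add: k_def)
    have u: "u > 0" using n k1 by (simp add: u_def)
    have scale: "sqrt u * (\<sigma> n * sqrt (real k)) = \<sigma> n * sqrt (real n)"
      using k1 by (simp add: u_def real_sqrt_divide)
    have "(\<sigma> n * sqrt (real n)) *\<^sub>R (statistic X T n k \<omega>' - \<theta> n) = sqrt u *\<^sub>R ?Y \<omega>' + u *\<^sub>R a_seq n" for \<omega>'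
    proof -
      have "sqrt u *\<^sub>R ?Y \<omega>' = (sqrt u * (\<sigma> n * sqrt (real k))) *\<^sub>R (statistic X T n k \<omega>' - \<theta> n)
          - (sqrt u * sqrt u) *\<^sub>R a_seq n"
        by (simp only: Y_eq[OF n k1] u_def[symmetric]
            scaleR_diff_right scaleR_scaleR)
      then show ?thesis using u by (simp add: scale)
    qed
    then have "g (statistic X T n k \<omega>' - \<theta> n)
        = iexp ((sqrt u *\<^sub>R t) \<bullet> ?Y \<omega>') * iexp (u * (t \<bullet> a_seq n) - t \<bullet> b_seq n)" for \<omega>'
      unfolding g_def exp_add[symmetric]
      by (intro arg_cong[of _ _ exp]) (simp add: inner_simps algebra_simps)
    then have "(CLINT \<omega>'|M. g (statistic X T n k \<omega>' - \<theta> n))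
        = (CLINT \<omega>'|M. iexp ((sqrt u *\<^sub>R t) \<bullet> ?Y \<omega>')) * iexp (u * (t \<bullet> a_seq n) - t \<bullet> b_seq n)"
      by (simp only: integral_mult_left_zero)
    also have "(CLINT \<omega>'|M. iexp ((sqrt u *\<^sub>R t) \<bullet> ?Y \<omega>')) = h n k (sqrt u *\<^sub>R t)"
      by (simp only: h_char[OF n k1] char_vec_distr[OF normalized_statistic_measurable[OF n k1]])
    finally show "(CLINT \<omega>'|M. g (statistic X T n (N n \<omega>) \<omega>' - \<theta> n))
        = h n (N n \<omega>) (sqrt (U n \<omega>) *\<^sub>R t) * iexp (U n \<omega> * (t \<bullet> a_seq n) - t \<bullet> b_seq n)"
      by (simp only: k_def u_def)
  qed
  finally show ?thesis .
qed

lemma norm_h_le: "n \<ge> 1 \<Longrightarrow> k \<ge> 1 \<Longrightarrow> norm (h n k t) \<le> 1"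
  by (simp only: h_char) (intro norm_char_vec_le borel_prob_distr prob_space_axioms
      normalized_statistic_measurable)

text \<open>
  The integrand of the hypothesis of asymptotic normality, for a fixed sample size \<open>k\<close>.
\<close>

definition discrepancy :: "real \<Rightarrow> nat \<Rightarrow> nat \<Rightarrow> real" where
  "discrepancy \<tau> n k = (SUP t\<in>cball 0 \<tau>.
     cmod (h n k t - complex_of_real (exp (- (1/2) * (t \<bullet> (\<Sigma> *v t))))))"

lemma \<Sigma>_nonneg: "0 \<le> t \<bullet> (\<Sigma> *v t)"
  using \<Sigma>_pos_def by (cases "t = 0") (auto simp: pos_def_sym_def less_imp_le)

lemma norm_h_diff_le_2:
  assumes "n \<ge> 1" "k \<ge> 1"
  shows "cmod (h n k t - complex_of_real (exp (- (1/2) * (t \<bullet> (\<Sigma> *v t))))) \<le> 2"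
proof -
  have "cmod (complex_of_real (exp (- (1/2) * (t \<bullet> (\<Sigma> *v t))))) \<le> 1"
    using \<Sigma>_nonneg[of t] by simp
  then show ?thesis using norm_h_le[OF assms, of t] norm_triangle_ineq4[of "h n k t"] by (smt (verit))
qed

lemma le_discrepancy:
  assumes "n \<ge> 1" "k \<ge> 1" "norm t \<le> \<tau>"
  shows "cmod (h n k t - complex_of_real (exp (- (1/2) * (t \<bullet> (\<Sigma> *v t))))) \<le> discrepancy \<tau> n k"
  unfolding discrepancy_def
  using norm_h_diff_le_2[OF assms(1,2)] assms(3)
  by (intro cSUP_upper) (auto intro!: bdd_aboveI2)

lemma discrepancy_bounds:
  assumes "n \<ge> 1" "k \<ge> 1" "\<tau> > 0"
  shows "0 \<le> discrepancy \<tau> n k" "discrepancy \<tau> n k \<le> 2"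
proof -
  show "0 \<le> discrepancy \<tau> n k"
    using assms(3) by (intro order_trans[OF norm_ge_zero le_discrepancy[OF assms(1,2), of 0 \<tau>]]) simp
  show "discrepancy \<tau> n k \<le> 2"
    unfolding discrepancy_def using norm_h_diff_le_2[OF assms(1,2)] assms(3)
    by (intro cSUP_least) auto
qed

lemma integrable_discrepancy:
  assumes n: "n \<ge> 1" and \<tau>: "\<tau> > 0"
  shows "integrable M (\<lambda>\<omega>. discrepancy \<tau> n (N n \<omega>))"
proof (rule integrable_const_bound[of _ 2])
  show "AE \<omega> in M. norm (discrepancy \<tau> n (N n \<omega>)) \<le> 2"
    using discrepancy_bounds[OF n N_pos[OF n] \<tau>] by (intro AE_I2) simp
  show "(\<lambda>\<omega>. discrepancy \<tau> n (N n \<omega>)) \<in> borel_measurable M"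
    by (rule measurable_compose[OF N_meas[OF n]]) simp
qed

lemma discrepancy_tendsto: "\<tau> > 0 \<Longrightarrow> (\<lambda>n. \<integral>\<omega>. discrepancy \<tau> n (N n \<omega>) \<partial>M) \<longlonglongrightarrow> 0"
  unfolding discrepancy_def by (rule asymp_normal)

lemma U_tail:
  assumes "e > 0"
  obtains K where "K > 0" "\<And>n. prob {\<omega> \<in> space M. U n \<omega> > K} < e"
proof -
  obtain K where K: "K > 0" "\<And>\<mu>. \<mu> \<in> {U_law n | n. n \<ge> 1} \<Longrightarrow> measure \<mu> {K<..} < e"
    using weakly_relatively_compact_tail[OF N_compact _ assms] real_distribution_U_law by blast
  have "prob {\<omega> \<in> space M. U n \<omega> > K} < e" for n
  proof (cases "n = 0")
    case True
    then show ?thesis using K(1) assms by (simp add: not_less)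
  next
    case False
    then have "measure (U_law n) {K<..} < e" by (intro K(2)) auto
    also have "measure (U_law n) {K<..} = prob {\<omega> \<in> space M. U n \<omega> > K}"
      by (subst measure_distr) (auto intro!: arg_cong[of _ _ prob])
    finally show ?thesis .
  qed
  then show thesis using that K(1) by blast
qed

lemma tight_U_law: "tight U_law"
  unfolding tight_def
proof (intro conjI allI impI real_distribution_U_law)
  fix e :: real assume "e > 0"
  then obtain K where K: "K > 0" "\<And>n. prob {\<omega> \<in> space M. U n \<omega> > K} < e"
    using U_tail by blast
  have "measure (U_law n) {-1<..K} > 1 - e" for n
  proof -
    have "- 1 < U n \<omega>" for \<omega> by (rule less_le_trans[of _ 0]) auto
    then have "U n -` {-1<..K} \<inter> space M = space M - {\<omega> \<in> space M. U n \<omega> > K}"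
      by (auto simp: not_less)
    then have "measure (U_law n) {-1<..K} = prob (space M - {\<omega> \<in> space M. U n \<omega> > K})"
      by (subst measure_distr) auto
    also have "\<dots> = 1 - prob {\<omega> \<in> space M. U n \<omega> > K}" by (rule prob_compl) measurable
    finally show ?thesis using K(2)[of n] by simp
  qed
  then show "\<exists>a b. a < b \<and> (\<forall>n. 1 - e < measure (U_law n) {a<..b})"
    using K(1) by (intro exI[of _ "-1"] exI[of _ K]) auto
qed

text \<open>
  The characteristic function of the normal law with mean \<open>u a - b\<close> and covariance matrix \<open>u \<Sigma>\<close>,
  provided that \<open>u \<ge> 0\<close>.
\<close>

definition mixture_kernel :: "real^'m \<Rightarrow> real \<Rightarrow> complex" where
  "mixture_kernel t u = exp (\<i> * (t \<bullet> (- b + u *\<^sub>R a)) - u * (t \<bullet> (\<Sigma> *v t)) / 2)"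

lemma mixture_kernel_measurable [measurable]: "mixture_kernel t \<in> borel_measurable borel"
  unfolding mixture_kernel_def[abs_def] by measurable

lemma norm_mixture_kernel_le: "u \<ge> 0 \<Longrightarrow> norm (mixture_kernel t u) \<le> 1"
  using \<Sigma>_nonneg[of t] by (simp add: mixture_kernel_def)

text \<open>
  For \<open>u \<le> K\<close> the vector \<open>\<surd>u t\<close> lies in the ball of radius \<open>\<surd>K \<parallel>t\<parallel>\<close>, where the discrepancy controls
  \<open>h\<close>, and the phases differ by at most the last bracket. For \<open>u > K\<close> only the trivial bound \<open>2\<close> is
  left, but this happens with small probability. The summand \<open>1\<close> keeps the radius positive when
  \<open>t = 0\<close>.
\<close>

lemma pointwise_bound:
  assumes n: "n \<ge> 1" and k: "k \<ge> 1" and K: "K > 0"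
  defines "u \<equiv> real n / real k"
  shows "norm (h n k (sqrt u *\<^sub>R t) * iexp (u * (t \<bullet> a_seq n) - t \<bullet> b_seq n) - mixture_kernel t u)
    \<le> 2 * indicator {K<..} u + discrepancy (sqrt K * norm t + 1) n k
      + (K * norm t * norm (a_seq n - a) + norm t * norm (b_seq n - b))" (is "?L \<le> _")
proof (cases "u > K")
  case True
  have u: "u \<ge> 0" by (simp add: u_def)
  have "?L \<le> norm (h n k (sqrt u *\<^sub>R t) * iexp (u * (t \<bullet> a_seq n) - t \<bullet> b_seq n)) + norm (mixture_kernel t u)"
    by (rule norm_triangle_ineq4)
  also have "\<dots> \<le> 1 + 1"
    using norm_h_le[OF n k] norm_mixture_kernel_le[OF u] by (intro add_mono) (auto simp: norm_mult)
  finally have "?L \<le> 2" by simp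
  moreover have "0 \<le> discrepancy (sqrt K * norm t + 1) n k"
    using K by (intro discrepancy_bounds n k) (simp add: add_nonneg_pos)
  moreover have "0 \<le> K * norm t * norm (a_seq n - a) + norm t * norm (b_seq n - b)"
    using K by simp
  ultimately show ?thesis using True by simp
next
  case False
  have u: "u \<ge> 0" "u \<le> K" using False by (auto simp: u_def)
  let ?E = "complex_of_real (exp (- (1/2) * ((sqrt u *\<^sub>R t) \<bullet> (\<Sigma> *v (sqrt u *\<^sub>R t)))))"
  let ?\<alpha> = "u * (t \<bullet> a_seq n) - t \<bullet> b_seq n" and ?\<beta> = "u * (t \<bullet> a) - t \<bullet> b"
  have q: "(sqrt u *\<^sub>R t) \<bullet> (\<Sigma> *v (sqrt u *\<^sub>R t)) = u * (t \<bullet> (\<Sigma> *v t))"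
    using u by (simp add: matrix_vector_mult_scaleR flip: mult.assoc)
  have kernel: "mixture_kernel t u = ?E * iexp ?\<beta>"
    unfolding q mixture_kernel_def exp_of_real[symmetric] exp_add[symmetric]
    by (rule arg_cong[of _ _ exp]) (simp add: inner_simps algebra_simps)
  have E_le: "norm ?E \<le> 1" using \<Sigma>_nonneg[of "sqrt u *\<^sub>R t"] by simp
  have "sqrt u * norm t \<le> sqrt K * norm t" using u by (intro mult_right_mono) auto
  then have disc: "norm (h n k (sqrt u *\<^sub>R t) - ?E) \<le> discrepancy (sqrt K * norm t + 1) n k"
    using u by (intro le_discrepancy n k) simp
  have "?L = norm ((h n k (sqrt u *\<^sub>R t) - ?E) * iexp ?\<alpha> + ?E * (iexp ?\<alpha> - iexp ?\<beta>))"
    unfolding kernel by (simp add: algebra_simps)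
  also have "\<dots> \<le> norm ((h n k (sqrt u *\<^sub>R t) - ?E) * iexp ?\<alpha>) + norm (?E * (iexp ?\<alpha> - iexp ?\<beta>))"
    by (rule norm_triangle_ineq)
  also have "norm ((h n k (sqrt u *\<^sub>R t) - ?E) * iexp ?\<alpha>) = norm (h n k (sqrt u *\<^sub>R t) - ?E)"
    by (simp only: norm_mult norm_exp_i_times mult_1_right)
  also have "norm (?E * (iexp ?\<alpha> - iexp ?\<beta>)) \<le> 1 * \<bar>?\<alpha> - ?\<beta>\<bar>"
    unfolding norm_mult by (intro mult_mono E_le norm_iexp_diff_le) auto
  also have "\<bar>?\<alpha> - ?\<beta>\<bar> \<le> K * norm t * norm (a_seq n - a) + norm t * norm (b_seq n - b)"
  proof -
    have "?\<alpha> - ?\<beta> = u * (t \<bullet> (a_seq n - a)) - t \<bullet> (b_seq n - b)" by (simp add: inner_simps algebra_simps)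
    also have "\<bar>\<dots>\<bar> \<le> u * \<bar>t \<bullet> (a_seq n - a)\<bar> + \<bar>t \<bullet> (b_seq n - b)\<bar>"
      using u by (intro order_trans[OF abs_triangle_ineq4]) (simp add: abs_mult)
    also have "\<dots> \<le> K * (norm t * norm (a_seq n - a)) + norm t * norm (b_seq n - b)"
      using u by (intro add_mono mult_mono Cauchy_Schwarz_ineq2) auto
    finally show ?thesis by (simp add: mult.assoc)
  qed
  finally show ?thesis using disc False by simp
qed

text \<open>
  Integration of the pointwise bound leaves three terms: the tail of \<open>U n\<close>, which is small uniformly in
  \<open>n\<close> for large \<open>K\<close>, the mean discrepancy on a fixed ball, and the deviation of the centring
  vectors from their limits.
\<close>

lemma char_Z_law_minus_mixture_tendsto:
  "(\<lambda>n. char_vec (Z_law n) t - (CLINT \<omega>|M. mixture_kernel t (U n \<omega>))) \<longlonglongrightarrow> 0"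
proof (rule LIMSEQ_I)
  fix r :: real assume r: "r > 0"
  obtain K where K: "K > 0" "\<And>n. prob {\<omega> \<in> space M. U n \<omega> > K} < r / 8"
    using U_tail[of "r / 8"] r by auto
  define \<tau> where "\<tau> = sqrt K * norm t + 1"
  have \<tau>: "\<tau> > 0" using K by (simp add: \<tau>_def add_nonneg_pos)
  define \<delta> where "\<delta> n = K * norm t * norm (a_seq n - a) + norm t * norm (b_seq n - b)" for n
  have "(\<lambda>n. norm (a_seq n - a)) \<longlonglongrightarrow> 0" "(\<lambda>n. norm (b_seq n - b)) \<longlonglongrightarrow> 0"
    using a_lim b_lim by (simp_all add: LIM_zero tendsto_norm_zero)
  then have "\<delta> \<longlonglongrightarrow> 0"
    unfolding \<delta>_def[abs_def] by (intro tendsto_add_zero tendsto_mult_right_zero)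
  then have ev1: "eventually (\<lambda>n. \<delta> n < r / 4) sequentially"
    using r by (intro order_tendstoD) auto
  have ev2: "eventually (\<lambda>n. (\<integral>\<omega>. discrepancy \<tau> n (N n \<omega>) \<partial>M) < r / 4) sequentially"
    using discrepancy_tendsto[OF \<tau>] r by (intro order_tendstoD) auto
  have bound: "norm (char_vec (Z_law n) t - (CLINT \<omega>|M. mixture_kernel t (U n \<omega>)))
      \<le> 2 * prob {\<omega> \<in> space M. U n \<omega> > K} + (\<integral>\<omega>. discrepancy \<tau> n (N n \<omega>) \<partial>M) + \<delta> n"
    if n: "n \<ge> 1" for n
  proof -
    define f where "f \<omega> = h n (N n \<omega>) (sqrt (U n \<omega>) *\<^sub>R t) * iexp (U n \<omega> * (t \<bullet> a_seq n) - t \<bullet> b_seq n)" for \<omega>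
    have f_meas: "f \<in> borel_measurable M"
      unfolding f_def by (rule measurable_compose[OF N_meas[OF n]]) simp
    have f_int: "integrable M f"
    proof (rule integrable_const_bound[OF _ f_meas])
      show "AE \<omega> in M. norm (f \<omega>) \<le> 1"
        using norm_h_le[OF n N_pos[OF n]] by (intro AE_I2) (simp add: f_def norm_mult)
    qed
    have m_int: "integrable M (\<lambda>\<omega>. mixture_kernel t (U n \<omega>))"
    proof (rule integrable_const_bound)
      show "AE \<omega> in M. norm (mixture_kernel t (U n \<omega>)) \<le> 1"
        by (intro AE_I2 norm_mixture_kernel_le) simp
    qed measurable
    have ind_int: "integrable M (\<lambda>\<omega>. indicator {\<omega> \<in> space M. U n \<omega> > K} \<omega> :: real)"
      by (intro integrable_real_indicator) (auto simp: emeasure_eq_measure)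
    have "char_vec (Z_law n) t - (CLINT \<omega>|M. mixture_kernel t (U n \<omega>))
        = (CLINT \<omega>|M. f \<omega> - mixture_kernel t (U n \<omega>))"
      unfolding char_Z_law[OF n] f_def[symmetric]
      by (rule Bochner_Integration.integral_diff[OF f_int m_int, symmetric])
    also have "norm \<dots> \<le> (\<integral>\<omega>. norm (f \<omega> - mixture_kernel t (U n \<omega>)) \<partial>M)"
      by (rule integral_norm_bound)
    also have "\<dots> \<le> (\<integral>\<omega>. 2 * indicator {\<omega> \<in> space M. U n \<omega> > K} \<omega> + discrepancy \<tau> n (N n \<omega>) + \<delta> n \<partial>M)"
    proof (rule integral_mono)
      fix \<omega> assume \<omega>: "\<omega> \<in> space M"
      then show "norm (f \<omega> - mixture_kernel t (U n \<omega>))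
          \<le> 2 * indicator {\<omega> \<in> space M. U n \<omega> > K} \<omega> + discrepancy \<tau> n (N n \<omega>) + \<delta> n"
        using pointwise_bound[OF n N_pos[OF n \<omega>] K(1), of t]
        by (simp add: f_def \<tau>_def \<delta>_def indicator_def)
    qed (intro integrable_norm Bochner_Integration.integrable_diff Bochner_Integration.integrable_add
          f_int m_int ind_int integrable_discrepancy n \<tau> integrable_const integrable_mult_right)+
    also have "\<dots> = 2 * prob {\<omega> \<in> space M. U n \<omega> > K} + (\<integral>\<omega>. discrepancy \<tau> n (N n \<omega>) \<partial>M) + \<delta> n"
      using ind_int integrable_discrepancy[OF n \<tau>] by (simp add: prob_space)
    finally show ?thesis .
  qed
  have "eventually (\<lambda>n. norm (char_vec (Z_law n) t - (CLINT \<omega>|M. mixture_kernel t (U n \<omega>)) - 0) < r) sequentially"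
    using ev1 ev2 eventually_ge_at_top[of 1]
  proof eventually_elim
    case (elim n)
    then show ?case using bound[of n] K(2)[of n] r by simp
  qed
  then show "\<exists>n0. \<forall>n\<ge>n0. norm (char_vec (Z_law n) t - (CLINT \<omega>|M. mixture_kernel t (U n \<omega>)) - 0) < r"
    by (simp add: eventually_sequentially)
qed

text \<open>
  The test function \<open>min 1 (max 0 (-x))\<close> vanishes on the values of \<open>U n\<close> and is positive on the negative half-line,
  so the limit law has no mass there.
\<close>

lemma mixing_law_limit:
  assumes s: "strict_mono s" and G: "real_distribution G" and conv: "weak_conv_m (U_law \<circ> s) G"
  shows "mixing_law G"
proof -
  interpret G: real_distribution G by (rule G)
  define f where "f x = min 1 (max 0 (- x))" for x :: real
  have f: "isCont f x" "\<bar>f x\<bar> \<le> 1" for x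
    unfolding f_def[abs_def] by (intro continuous_intros) (simp add: f_def)
  have f_meas [measurable]: "f \<in> borel_measurable borel" unfolding f_def[abs_def] by measurable
  have "(\<lambda>n. \<integral>x. f x \<partial>(U_law \<circ> s) n) \<longlonglongrightarrow> (\<integral>x. f x \<partial>G)"
    using f by (intro weak_conv_imp_integral_bdd_continuous_conv[OF _ G conv, of f 1])
      (auto simp: real_distribution_U_law)
  moreover have "(\<integral>x. f x \<partial>(U_law \<circ> s) n) = 0" for n
  proof -
    have "(\<integral>x. f x \<partial>(U_law \<circ> s) n) = (\<integral>\<omega>. f (U (s n) \<omega>) \<partial>M)"
      unfolding o_def by (rule integral_distr) measurable
    also have "(\<lambda>\<omega>. f (U (s n) \<omega>)) = (\<lambda>_. 0)" by (simp add: f_def fun_eq_iff)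
    finally show ?thesis by simp
  qed
  ultimately have f_0: "(\<integral>x. f x \<partial>G) = 0" by (simp add: LIMSEQ_const_iff)
  have f_int: "integrable G f" using f by (intro G.integrable_const_bound[of _ 1]) auto
  have f_nonneg: "AE x in G. 0 \<le> f x" by (simp add: f_def)
  have "AE x in G. f x = 0"
    using integral_nonneg_eq_0_iff_AE[OF f_int f_nonneg] f_0 by blast
  then have "AE x in G. x \<notin> {..<0}" by eventually_elim (auto simp: f_def)
  then have "{..<0} \<in> null_sets G" by (subst AE_iff_null_sets) auto
  then show ?thesis using G by (simp add: mixing_law_def measure_eq_0_null_sets)
qed

text \<open>
  Stated along a subsequence because the converse direction applies it to subsequential limits.
\<close>

lemma weak_conv_to_mixture:
  assumes s: "strict_mono s" and G: "real_distribution G" and conv: "weak_conv_m (U_law \<circ> s) G"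
  shows "weak_conv_vec (Z_law \<circ> s) (normal_var_mean_mixture (- b) a \<Sigma> G)"
proof (rule char_vec_tendsto_imp_weak_conv_vec)
  interpret G: real_distribution G by (rule G)
  have mix: "mixing_law G" by (rule mixing_law_limit[OF s G conv])
  show "borel_prob (normal_var_mean_mixture (- b) a \<Sigma> G)"
    by (rule borel_prob_mixture[OF \<Sigma>_pos_def mix])
  show "borel_prob ((Z_law \<circ> s) n)" for n by (simp add: borel_prob_Z_law)
  fix t
  \<comment> \<open>The kernel grows exponentially for \<open>u < 0\<close>; truncation makes it bounded and continuous on the
    line and changes nothing where the laws involved are concentrated.\<close>
  define H where "H u = mixture_kernel t (max u 0)" for u
  have H_cont: "isCont H u" for u
  proof -
    have "continuous_on UNIV H"
      unfolding H_def[abs_def] mixture_kernel_def by (intro continuous_intros) auto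
    then show ?thesis by (simp add: continuous_on_eq_continuous_at)
  qed
  have H_meas [measurable]: "H \<in> borel_measurable borel" unfolding H_def[abs_def] by measurable
  have "(\<lambda>n. CLINT u|(U_law \<circ> s) n. H u) \<longlonglongrightarrow> (CLINT u|G. H u)"
    using H_cont norm_mixture_kernel_le
    by (intro weak_conv_imp_integral_bdd_continuous_conv[OF _ G conv, of H 1])
      (auto simp: real_distribution_U_law H_def)
  moreover have "(CLINT u|(U_law \<circ> s) n. H u) = (CLINT \<omega>|M. mixture_kernel t (U (s n) \<omega>))" for n
  proof -
    have "(CLINT u|(U_law \<circ> s) n. H u) = (CLINT \<omega>|M. H (U (s n) \<omega>))"
      unfolding o_def by (rule integral_distr) measurable
    then show ?thesis by (simp add: H_def)
  qed
  moreover have "(CLINT u|G. H u) = char_vec (normal_var_mean_mixture (- b) a \<Sigma> G) t"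
    unfolding char_mixture[OF \<Sigma>_pos_def mix] mixture_kernel_def[symmetric]
  proof (rule integral_cong_AE)
    show "AE u in G. H u = mixture_kernel t u"
      using mixing_law_AE_nonneg[OF mix] by eventually_elim (simp add: H_def)
  qed measurable
  ultimately have "(\<lambda>n. CLINT \<omega>|M. mixture_kernel t (U (s n) \<omega>))
      \<longlonglongrightarrow> char_vec (normal_var_mean_mixture (- b) a \<Sigma> G) t" by simp
  moreover have "(\<lambda>n. char_vec (Z_law (s n)) t - (CLINT \<omega>|M. mixture_kernel t (U (s n) \<omega>))) \<longlonglongrightarrow> 0"
    using LIMSEQ_subseq_LIMSEQ[OF char_Z_law_minus_mixture_tendsto s] by (simp add: o_def)
  ultimately show "(\<lambda>n. char_vec ((Z_law \<circ> s) n) t) \<longlonglongrightarrow> char_vec (normal_var_mean_mixture (- b) a \<Sigma> G) t"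
    using tendsto_add by fastforce
qed

lemma weak_conv_vec_subseq:
  assumes "weak_conv_vec \<nu> F" "strict_mono s"
  shows "weak_conv_vec (\<nu> \<circ> s) F"
  using assms LIMSEQ_subseq_LIMSEQ[OF _ assms(2)] unfolding weak_conv_vec_def o_def by blast

text \<open>
  Every subsequential limit of the laws of \<open>U n\<close> is a mixing law of the same mixture \<open>F\<close>; by
  identifiability there is only one, and a tight sequence with only one subsequential limit converges.
\<close>

theorem weak_conv_iff_mixture:
  assumes F: "borel_prob F"
  shows "weak_conv_vec Z_law F \<longleftrightarrow>
    (\<exists>G. mixing_law G \<and> F = normal_var_mean_mixture (- b) a \<Sigma> G \<and> weak_conv_m U_law G)"
proof
  assume "\<exists>G. mixing_law G \<and> F = normal_var_mean_mixture (- b) a \<Sigma> G \<and> weak_conv_m U_law G"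
  then show "weak_conv_vec Z_law F"
    using weak_conv_to_mixture[of "\<lambda>n. n"] by (auto simp: mixing_law_def strict_mono_def o_def)
next
  assume conv: "weak_conv_vec Z_law F"
  have F_eq: "F = normal_var_mean_mixture (- b) a \<Sigma> \<nu>" and \<nu>_mix: "mixing_law \<nu>"
    if s: "strict_mono s" and \<nu>: "real_distribution \<nu>" "weak_conv_m (U_law \<circ> s) \<nu>" for s \<nu>
  proof -
    show mix: "mixing_law \<nu>" by (rule mixing_law_limit[OF s \<nu>])
    show "F = normal_var_mean_mixture (- b) a \<Sigma> \<nu>"
      by (rule weak_conv_vec_unique[OF F borel_prob_mixture[OF \<Sigma>_pos_def mix]
            weak_conv_vec_subseq[OF conv s] weak_conv_to_mixture[OF s \<nu>]])
  qed
  obtain r G where r: "strict_mono r" and G: "real_distribution G" "weak_conv_m (U_law \<circ> r) G"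
    using tight_imp_convergent_subsubsequence[OF tight_U_law strict_mono_id] by auto
  have "weak_conv_m U_law G"
  proof (rule tight_subseq_weak_converge[OF real_distribution_U_law G(1) tight_U_law])
    fix s \<nu> assume s: "strict_mono s" and \<nu>: "real_distribution \<nu>" "weak_conv_m (U_law \<circ> s) \<nu>"
    have "\<nu> = G"
      using F_eq[OF s \<nu>] F_eq[OF r G]
      by (intro mixture_inject[where a=a and b="- b", OF \<Sigma>_pos_def \<nu>_mix[OF s \<nu>] \<nu>_mix[OF r G]]) simp
    then show "weak_conv_m (U_law \<circ> s) G" using \<nu> by simp
  qed
  then show "\<exists>G. mixing_law G \<and> F = normal_var_mean_mixture (- b) a \<Sigma> G \<and> weak_conv_m U_law G"
    using F_eq[OF r G] \<nu>_mix[OF r G] by blast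
qed

corollary weak_conv_exists_iff:
  "(\<exists>F. borel_prob F \<and> weak_conv_vec Z_law F) \<longleftrightarrow> (\<exists>G. mixing_law G \<and> weak_conv_m U_law G)"
  using weak_conv_iff_mixture borel_prob_mixture[OF \<Sigma>_pos_def] by blast

end

theorem theorem3:
  fixes M :: "'w measure"
    and X :: "nat \<Rightarrow> nat \<Rightarrow> 'w \<Rightarrow> real^'r"
    and T :: "nat \<Rightarrow> nat \<Rightarrow> (nat \<Rightarrow> real^'r) \<Rightarrow> real^'m"
    and \<theta> a_seq b_seq :: "nat \<Rightarrow> real^'m"
    and a b :: "real^'m"
    and \<sigma> :: "nat \<Rightarrow> real"
    and N :: "nat \<Rightarrow> 'w \<Rightarrow> nat"
    and \<Sigma> :: "real^'m^'m"
    and h :: "nat \<Rightarrow> nat \<Rightarrow> real^'m \<Rightarrow> complex"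
  assumes prob: "prob_space M"
    and X_indep: "\<And>n. n \<ge> 1 \<Longrightarrow> prob_space.indep_vars M (\<lambda>_. borel) (X n) {1..}"
    and T_meas: "\<And>n k. n \<ge> 1 \<Longrightarrow> k \<ge> 1 \<Longrightarrow> T n k \<in> borel_measurable (PiM {1..k} (\<lambda>_. borel))"
    and N_meas: "\<And>n. n \<ge> 1 \<Longrightarrow> N n \<in> measurable M (count_space UNIV)"
    and N_pos: "\<And>n \<omega>. n \<ge> 1 \<Longrightarrow> \<omega> \<in> space M \<Longrightarrow> N n \<omega> \<ge> 1"
    and N_T_indep: "\<And>n k. n \<ge> 1 \<Longrightarrow> k \<ge> 1 \<Longrightarrow>
        indep_rv M (count_space UNIV) (N n) borel (\<lambda>\<omega>. statistic X T n k \<omega> - \<theta> n)"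
    and N_compact: "weakly_relatively_compact
        {distr M borel (\<lambda>\<omega>. real n / real (N n \<omega>)) | n. n \<ge> 1}"
    and \<sigma>_pos: "\<And>n. n \<ge> 1 \<Longrightarrow> \<sigma> n > 0"
    and a_lim: "a_seq \<longlonglongrightarrow> a"
    and b_lim: "b_seq \<longlonglongrightarrow> b"
    and \<Sigma>_pos_def: "pos_def_sym \<Sigma>"
    and h_char: "\<And>n k t. n \<ge> 1 \<Longrightarrow> k \<ge> 1 \<Longrightarrow>
        h n k t = char_vec (distr M borel (normalized_statistic X T \<theta> \<sigma> a_seq n k)) t"
    and asymp_normal: "\<And>\<tau>::real. \<tau> > 0 \<Longrightarrow>
        (\<lambda>n. \<integral>\<omega>. (SUP t\<in>cball 0 \<tau>.
               cmod (h n (N n \<omega>) t - complex_of_real (exp (- (1/2) * (t \<bullet> (\<Sigma> *v t)))))) \<partial>M)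
          \<longlonglongrightarrow> 0"
  shows "((\<exists>F. borel_prob F \<and>
               weak_conv_vec (\<lambda>n. distr M borel (random_size_statistic X T \<theta> \<sigma> b_seq N n)) F)
          \<longleftrightarrow>
          (\<exists>G. mixing_law G \<and>
               weak_conv_m (\<lambda>n. distr M borel (\<lambda>\<omega>. real n / real (N n \<omega>))) G))
       \<and> (\<forall>F. borel_prob F \<longrightarrow>
          (weak_conv_vec (\<lambda>n. distr M borel (random_size_statistic X T \<theta> \<sigma> b_seq N n)) F
           \<longleftrightarrow>
           (\<exists>G. mixing_law G \<and> F = normal_var_mean_mixture (- b) a \<Sigma> G \<and>
               weak_conv_m (\<lambda>n. distr M borel (\<lambda>\<omega>. real n / real (N n \<omega>))) G)))"
proof -
  interpret prob_space M by (rule prob)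
  interpret random_sample_size M X T \<theta> a_seq b_seq a b \<sigma> N \<Sigma> h
    by unfold_locales (fact assms)+
  show ?thesis
    using weak_conv_exists_iff weak_conv_iff_mixture by blast
qed

end
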